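(* Let $\Phi$ be a finite crystallographic root system or a rank $3$ untwisted affine root system, let $I$ be an order ideal in the root poset on $\Phi^+$, and let $B$ be biclosed in $I$. Then there is a unique minimal biclosed set $\overline{B}$ in $\Phi^+$ such that $\overline{B}\cap I=B$.
   Context: Root systems are (symmetrizable, crystallographic, real, reduced) root systems $\Phi$ in a real vector space $V$ with symmetric bilinear form, base $\Pi$, and positive roots $\Phi^+=\Phi\cap\mathrm{Span}_+\Pi$, where $\mathrm{Span}_+$ means nonnegative linear combinations. Untwisted affine root systems are affinizations $\{\alpha+k\delta:\alpha\in\Phi_0,k\in\mathbb{Z}\}$ of finite irreducible root systems $\Phi_0$ (imaginary roots $k\delta$ excluded), with base $\Pi_0\cup\{\delta-\theta\}$, $\theta$ the highest root. The root poset: $\alpha\le\beta$ iff $\beta-\alpha\in\mathrm{Span}_+\Pi$. For $X\subseteq V$ and $B\subseteq X$: $B$ is closed in $X$ if $\alpha,\beta\in B$, $\gamma\in\mathrm{Span}_+(\alpha,\beta)\cap X$ imply $\gamma\in B$; coclosed in $X$ if $X\setminus B$ is closed in $X$; biclosed if closed and coclosed. *)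

theory Defs
  imports "HOL-Analysis.Analysis"
begin

definition span_plus :: "'v::real_vector set \<Rightarrow> 'v set" where
  "span_plus S = {\<Sum>v\<in>S. c v *\<^sub>R v | c. \<forall>v\<in>S. 0 \<le> c v}"

definition finite_root_system :: "'a::euclidean_space set \<Rightarrow> bool" where
  "finite_root_system \<Phi> \<longleftrightarrow>
     finite \<Phi> \<and> 0 \<notin> \<Phi> \<and>
     (\<forall>\<alpha>\<in>\<Phi>. \<forall>\<beta>\<in>\<Phi>. \<beta> - (2 * (\<beta> \<bullet> \<alpha>) / (\<alpha> \<bullet> \<alpha>)) *\<^sub>R \<alpha> \<in> \<Phi>) \<and>
     (\<forall>\<alpha>\<in>\<Phi>. \<forall>\<beta>\<in>\<Phi>. 2 * (\<beta> \<bullet> \<alpha>) / (\<alpha> \<bullet> \<alpha>) \<in> \<int>) \<and>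
     (\<forall>\<alpha>\<in>\<Phi>. \<forall>c::real. c *\<^sub>R \<alpha> \<in> \<Phi> \<longrightarrow> c = 1 \<or> c = -1)"

definition is_base :: "'a::euclidean_space set \<Rightarrow> 'a set \<Rightarrow> bool" where
  "is_base \<Phi> \<Delta> \<longleftrightarrow> \<Delta> \<subseteq> \<Phi> \<and> independent \<Delta> \<and>
     (\<forall>\<beta>\<in>\<Phi>. \<exists>c::'a \<Rightarrow> int. ((\<forall>\<alpha>\<in>\<Delta>. 0 \<le> c \<alpha>) \<or> (\<forall>\<alpha>\<in>\<Delta>. c \<alpha> \<le> 0)) \<and>
                 \<beta> = (\<Sum>\<alpha>\<in>\<Delta>. of_int (c \<alpha>) *\<^sub>R \<alpha>))"

definition irreducible_rs :: "'a::euclidean_space set \<Rightarrow> bool" where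
  "irreducible_rs \<Phi> \<longleftrightarrow> \<Phi> \<noteq> {} \<and>
     \<not> (\<exists>A B. A \<union> B = \<Phi> \<and> A \<noteq> {} \<and> B \<noteq> {} \<and> (\<forall>a\<in>A. \<forall>b\<in>B. a \<bullet> b = 0))"

definition pos_roots :: "'v::real_vector set \<Rightarrow> 'v set \<Rightarrow> 'v set" where
  "pos_roots \<Phi> \<Delta> = \<Phi> \<inter> span_plus \<Delta>"

definition root_le :: "'v::real_vector set \<Rightarrow> 'v \<Rightarrow> 'v \<Rightarrow> bool" where
  "root_le \<Delta> \<alpha> \<beta> \<longleftrightarrow> \<beta> - \<alpha> \<in> span_plus \<Delta>"

definition highest_root :: "'a::euclidean_space set \<Rightarrow> 'a set \<Rightarrow> 'a \<Rightarrow> bool" where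
  "highest_root \<Phi> \<Delta> \<theta> \<longleftrightarrow> \<theta> \<in> pos_roots \<Phi> \<Delta> \<and>
     (\<forall>\<beta>\<in>pos_roots \<Phi> \<Delta>. root_le \<Delta> \<beta> \<theta>)"

(* untwisted affinization, realised in V = V0 \<times> R with delta = (0,1) *)
definition aff_roots :: "'a::euclidean_space set \<Rightarrow> ('a \<times> real) set" where
  "aff_roots \<Phi>0 = {(\<alpha>, of_int k) | \<alpha> k. \<alpha> \<in> \<Phi>0}"

definition aff_base :: "'a::euclidean_space set \<Rightarrow> 'a \<Rightarrow> ('a \<times> real) set" where
  "aff_base \<Delta>0 \<theta> = (\<lambda>\<alpha>. (\<alpha>, 0)) ` \<Delta>0 \<union> {(- \<theta>, 1)}"

definition order_ideal :: "'v::real_vector set \<Rightarrow> 'v set \<Rightarrow> 'v set \<Rightarrow> bool" where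
  "order_ideal \<Phi> \<Delta> I \<longleftrightarrow> I \<subseteq> pos_roots \<Phi> \<Delta> \<and>
     (\<forall>\<beta>\<in>I. \<forall>\<alpha>\<in>pos_roots \<Phi> \<Delta>. root_le \<Delta> \<alpha> \<beta> \<longrightarrow> \<alpha> \<in> I)"

definition closed_in_set :: "'v::real_vector set \<Rightarrow> 'v set \<Rightarrow> bool" where
  "closed_in_set X B \<longleftrightarrow>
     (\<forall>\<alpha>\<in>B. \<forall>\<beta>\<in>B. \<forall>\<gamma>\<in>span_plus {\<alpha>, \<beta>} \<inter> X. \<gamma> \<in> B)"

definition coclosed_in_set :: "'v::real_vector set \<Rightarrow> 'v set \<Rightarrow> bool" where
  "coclosed_in_set X B \<longleftrightarrow> closed_in_set X (X - B)"

definition biclosed_in :: "'v::real_vector set \<Rightarrow> 'v set \<Rightarrow> bool" where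
  "biclosed_in X B \<longleftrightarrow> B \<subseteq> X \<and> closed_in_set X B \<and> coclosed_in_set X B"

definition biclosed_extension_property :: "'v::real_vector set \<Rightarrow> 'v set \<Rightarrow> bool" where
  "biclosed_extension_property \<Phi> \<Delta> \<longleftrightarrow>
     (\<forall>I B. order_ideal \<Phi> \<Delta> I \<and> biclosed_in I B \<longrightarrow>
        (\<exists>!Bb. biclosed_in (pos_roots \<Phi> \<Delta>) Bb \<and> Bb \<inter> I = B \<and>
              (\<forall>C. biclosed_in (pos_roots \<Phi> \<Delta>) C \<and> C \<inter> I = B \<and> C \<subseteq> Bb \<longrightarrow> C = Bb)))"

end

theory Submission
  imports Defs
begin

text \<open>The least extension is found by adding the remaining positive roots one at a time, always a root
  \<open>\<beta>\<close> minimal outside the current ideal \<open>J\<close>, and putting \<open>\<beta>\<close> into the set only if closedness forces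
  this. All of it goes through once \<open>\<beta>\<close> is never forced both by the set \<open>X\<close> and by its complement \<open>Y\<close>
  in \<open>J\<close>. A forced \<open>\<beta>\<close> is, up to an exception in the affine case, a sum of two roots, so suppose
  \<open>\<beta> = \<alpha>\<^sub>1 + \<alpha>\<^sub>2 = \<gamma>\<^sub>1 + \<gamma>\<^sub>2\<close> with \<open>\<alpha>\<^sub>i \<in> X\<close> and \<open>\<gamma>\<^sub>j \<in> Y\<close>. Since \<open>(\<beta>, \<beta>) > 0\<close>, some \<open>(\<alpha>\<^sub>i, \<gamma>\<^sub>j)\<close>
  is positive, and \<open>\<alpha>\<^sub>i - \<gamma>\<^sub>j\<close> is a root unless it is imaginary. Say it is \<open>\<alpha>\<^sub>1 - \<gamma>\<^sub>1 = \<gamma>\<^sub>2 - \<alpha>\<^sub>2\<close> and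
  positive: it lies in \<open>J\<close>, and being in \<open>X\<close> it would put \<open>\<gamma>\<^sub>2\<close> into \<open>X\<close>, while being in \<open>Y\<close> it would
  put \<open>\<alpha>\<^sub>1\<close> into \<open>Y\<close>. In the affine case the remaining configurations concern strings
  \<open>x + k\<delta>\<close> and are settled by comparing with \<open>\<beta> - \<delta>\<close> and with the lowest roots of the opposite strings.\<close>

section \<open>Nonnegative spans and integrality\<close>

lemma span_plus_pair:
  "\<gamma> \<in> span_plus {\<alpha>, \<beta>} \<longleftrightarrow> (\<exists>a b. 0 \<le> a \<and> 0 \<le> b \<and> \<gamma> = a *\<^sub>R \<alpha> + b *\<^sub>R \<beta>)"
proof
  assume "\<gamma> \<in> span_plus {\<alpha>, \<beta>}"
  then obtain c where c: "\<forall>v\<in>{\<alpha>, \<beta>}. 0 \<le> c v" "\<gamma> = (\<Sum>v\<in>{\<alpha>, \<beta>}. c v *\<^sub>R v)"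
    unfolding span_plus_def by blast
  show "\<exists>a b. 0 \<le> a \<and> 0 \<le> b \<and> \<gamma> = a *\<^sub>R \<alpha> + b *\<^sub>R \<beta>"
  proof (cases "\<alpha> = \<beta>")
    case True
    then show ?thesis using c by (intro exI[of _ "c \<alpha>"] exI[of _ 0]) auto
  next
    case False
    then show ?thesis using c by (intro exI[of _ "c \<alpha>"] exI[of _ "c \<beta>"]) auto
  qed
next
  assume "\<exists>a b. 0 \<le> a \<and> 0 \<le> b \<and> \<gamma> = a *\<^sub>R \<alpha> + b *\<^sub>R \<beta>"
  then obtain a b where ab: "0 \<le> a" "0 \<le> b" "\<gamma> = a *\<^sub>R \<alpha> + b *\<^sub>R \<beta>" by blast
  show "\<gamma> \<in> span_plus {\<alpha>, \<beta>}"
  proof (cases "\<alpha> = \<beta>")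
    case True
    then show ?thesis using ab unfolding span_plus_def
      by (auto intro!: exI[of _ "\<lambda>_. a + b"] simp: scaleR_add_left)
  next
    case False
    then show ?thesis using ab unfolding span_plus_def
      by (auto intro!: exI[of _ "\<lambda>v. if v = \<alpha> then a else b"])
  qed
qed

lemma span_plus_add: "u \<in> span_plus S \<Longrightarrow> v \<in> span_plus S \<Longrightarrow> u + v \<in> span_plus S"
proof -
  assume "u \<in> span_plus S" "v \<in> span_plus S"
  then obtain c d where "\<forall>v\<in>S. 0 \<le> c v" "u = (\<Sum>v\<in>S. c v *\<^sub>R v)"
    "\<forall>v\<in>S. 0 \<le> d v" "v = (\<Sum>v\<in>S. d v *\<^sub>R v)" unfolding span_plus_def by blast
  then show ?thesis unfolding span_plus_def
    by (auto intro!: exI[of _ "\<lambda>v. c v + d v"] simp: scaleR_add_left sum.distrib)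
qed

lemma Ints_small: "x \<in> \<int> \<Longrightarrow> - 1 < x \<Longrightarrow> x < 1 \<Longrightarrow> x = (0::real)"
  by (metis Ints_cases Ints_nonzero_abs_less1 abs_less_iff minus_less_iff)

lemma cartan_product_cases:
  fixes m n :: real
  assumes "m \<in> \<int>" "n \<in> \<int>" "0 < m" "0 < n" "m * n < 4"
  shows "m = 1 \<or> n = 1"
proof (rule ccontr)
  assume "\<not> ?thesis"
  then have "m \<ge> 2" "n \<ge> 2" using assms
    by (auto elim!: Ints_cases)
  then have "m * n \<ge> 2 * 2" by (intro mult_mono) auto
  then show False using assms by simp
qed

lemma Cauchy_Schwarz_strict:
  fixes u v :: "'a::real_inner"
  assumes "v \<noteq> 0" "\<And>c. u \<noteq> c *\<^sub>R v"
  shows "(u \<bullet> v)\<^sup>2 < (u \<bullet> u) * (v \<bullet> v)"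
proof -
  let ?c = "(u \<bullet> v) / (v \<bullet> v)"
  have v: "v \<bullet> v > 0" using assms by simp
  have "0 < (u - ?c *\<^sub>R v) \<bullet> (u - ?c *\<^sub>R v)" using assms(2)[of ?c] by simp
  also have "\<dots> = u \<bullet> u - (u \<bullet> v)\<^sup>2 / (v \<bullet> v)" using v
    by (simp add: inner_diff inner_commute power2_eq_square field_simps)
  finally show ?thesis using v by (simp add: field_simps)
qed

text \<open>In rank two this is the configuration of simple roots \<open>v\<close> (long) and \<open>u - v\<close> (short) of
  \<open>G\<^sub>2\<close>, where \<open>w = v + 3 (u - v)\<close>.\<close>
lemma G2_coefficients:
  fixes u v w :: "'a::real_inner"
  assumes w: "u = a *\<^sub>R v + b *\<^sub>R w" and a: "0 < a" "a < 1" and b: "0 < b"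
    and nz: "u \<noteq> 0" "v \<noteq> 0" "w \<noteq> 0" and ind: "\<And>c. u \<noteq> c *\<^sub>R v"
    and uv: "0 < u \<bullet> v" and uw: "u \<bullet> w \<le> 0"
    and int: "2 * (u \<bullet> v) / (v \<bullet> v) \<in> \<int>" "2 * (v \<bullet> u) / (u \<bullet> u) \<in> \<int>"
      "2 * (w \<bullet> u) / (u \<bullet> u) \<in> \<int>" "2 * (u \<bullet> w) / (w \<bullet> w) \<in> \<int>"
      "2 * (v \<bullet> w) / (w \<bullet> w) \<in> \<int>" "2 * (w \<bullet> v) / (v \<bullet> v) \<in> \<int>"
  shows "a = 2/3" "b = 1/3" "u \<bullet> (u - v) < 0"
proof -
  define N where "N = u \<bullet> u"
  have N: "N > 0" and V: "v \<bullet> v > 0" using nz by (auto simp: N_def)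
  have eq: "N = a * (u \<bullet> v) + b * (u \<bullet> w)"
    unfolding N_def by (subst (2) w) (simp add: inner_add_right)
  \<comment> \<open>Dropping the nonpositive term and using a < 1 gives (u,u) < (u,v), so the Cartan
    integer \<open>m\<close> exceeds 2; with \<open>m * n < 4\<close> only \<open>m = 3\<close> and
    \<open>n = 1\<close> remain.\<close>
  have "N \<le> a * (u \<bullet> v)" using eq uw b by (simp add: mult_nonneg_nonpos)
  also have "\<dots> < u \<bullet> v" using a uv by simp
  finally have gt: "N < u \<bullet> v" .
  define m where "m = 2 * (v \<bullet> u) / N"
  define n where "n = 2 * (u \<bullet> v) / (v \<bullet> v)"
  have mi: "m \<in> \<int>" "n \<in> \<int>" using int by (auto simp: m_def n_def N_def)
  have m3: "m > 2" using gt N by (simp add: m_def field_simps inner_commute)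
  have mn4: "m * n < 4"
    using Cauchy_Schwarz_strict[OF nz(2) ind] N V
    by (simp add: m_def n_def N_def field_simps power2_eq_square inner_commute)
  have n0: "n > 0" using uv V by (simp add: n_def)
  have n1: "n = 1" using cartan_product_cases[OF mi _ n0 mn4] m3 by auto
  then have m: "m = 3" using mn4 m3 mi(1) by (auto elim!: Ints_cases)
  have uvN: "u \<bullet> v = 3/2 * N" using m N by (simp add: m_def field_simps inner_commute)
  have vv: "v \<bullet> v = 3 * N" using n1 V uvN by (simp add: n_def field_simps)
  show "u \<bullet> (u - v) < 0" using uvN N by (simp add: inner_diff_right flip: N_def)
  \<comment> \<open>\<open>x\<close> and \<open>y\<close> are the coordinates of \<open>w\<close> in
    the basis \<open>v\<close>, \<open>u - v\<close>; the goal becomes x = 1, y = 3.\<close>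
  define y where "y = 1 / b"
  define x where "x = (1 - a) / b"
  have x: "x > 0" using a b by (simp add: x_def)
  have weq: "w = y *\<^sub>R u - (y - x) *\<^sub>R v"
  proof -
    have "b *\<^sub>R w = u - a *\<^sub>R v" by (subst w) simp
    then have "w = (1/b) *\<^sub>R (u - a *\<^sub>R v)" using b by (metis divide_self_if less_irrefl scaleR_one scaleR_scaleR times_divide_eq_left mult_1)
    then show ?thesis using b by (simp add: x_def y_def scaleR_diff_right diff_divide_distrib)
  qed
  \<comment> \<open>The Cartan integer of \<open>w\<close> against \<open>u\<close> is
    \<open>- k\<close>, so \<open>k\<close> is an integer, nonnegative because (u,w) \<le>
    0.\<close>
  define k where "k = y - 3 * x"
  have y: "y = 3 * x + k" by (simp add: k_def)
  have vu: "v \<bullet> u = 3/2 * N" and uu: "u \<bullet> u = N"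
    using uvN by (simp_all add: inner_commute N_def)
  have wu: "w \<bullet> u = - k / 2 * N"
    unfolding weq inner_diff_left inner_scaleR_left vu uu y by (simp add: field_simps)
  have wv: "w \<bullet> v = - (3/2 * x + 3/2 * k) * N"
    unfolding weq inner_diff_left inner_scaleR_left uvN vv y by (simp add: field_simps)
  have ww: "w \<bullet> w = (3 * x\<^sup>2 + 3 * x * k + k\<^sup>2) * N"
    unfolding weq inner_diff_left inner_scaleR_left inner_diff_right inner_scaleR_right uvN vu uu vv y
    by (simp add: field_simps power2_eq_square)
  have kZ: "k \<in> \<int>" using int(3) N by (simp add: wu N_def[symmetric])
  have k0: "k \<ge> 0" using uw N by (simp add: inner_commute[of u w] wu zero_le_mult_iff)
  have "k = 0"
  proof (rule ccontr)
    assume "k \<noteq> 0"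
    then have k1: "k \<ge> 1" using kZ k0 by (auto elim!: Ints_cases)
    \<comment> \<open>\<open>q\<close> is (w,w)/(u,u). Since \<open>q > k\<close>, the integer
      2(u,w)/(w,w) = -k/q would lie strictly between -1 and 0.\<close>
    define q where "q = 3 * x\<^sup>2 + 3 * x * k + k\<^sup>2"
    have "k * 1 \<le> k * k" using k1 by (intro mult_left_mono) auto
    then have q: "q > k" using x k1 by (simp add: q_def power2_eq_square add_pos_pos add_pos_nonneg add_strict_increasing)
    have "2 * (u \<bullet> w) / (w \<bullet> w) = - k / q"
      using N q k1 by (simp add: inner_commute[of u w] wu ww q_def[symmetric])
    then have "k / q \<in> \<int>" using int(4) by (metis Ints_minus minus_divide_left minus_minus)
    moreover have "k / q < 1" "k / q > 0" using q k1 by auto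
    ultimately show False using Ints_small[of "k/q"] by auto
  qed
  have wv': "w \<bullet> v = - (3/2) * x * N" using wv \<open>k = 0\<close> by (simp add: algebra_simps)
  \<comment> \<open>With k = 0 the two Cartan integers of \<open>v\<close> and \<open>w\<close> are
    -x and -1/x.\<close>
  have x1: "x \<in> \<int>" "1 / x \<in> \<int>"
  proof -
    have "2 * (w \<bullet> v) / (v \<bullet> v) = - x" using N by (simp add: wv' vv)
    then show "x \<in> \<int>" using int(6) by (metis Ints_minus minus_minus)
    have "2 * (v \<bullet> w) / (w \<bullet> w) = - (1 / x)" using N x \<open>k = 0\<close>
      by (simp add: inner_commute[of v w] wv' ww power2_eq_square)
    then show "1 / x \<in> \<int>" using int(5) by (metis Ints_minus minus_minus)
  qed
  have "x = 1"
  proof (rule ccontr)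
    assume "x \<noteq> 1"
    then have "x > 1" using x1(1) x by (auto elim!: Ints_cases)
    then have "0 < 1 / x" "1 / x < 1" by auto
    then show False using Ints_small[OF x1(2)] by linarith
  qed
  then have "y = 3" using y \<open>k = 0\<close> by simp
  then show b3: "b = 1/3" using b by (simp add: y_def field_simps)
  show "a = 2/3" using \<open>x = 1\<close> b by (simp add: x_def b3)
qed

section \<open>Triples of positive roots\<close>

lemma nat_floor_less:
  fixes x y :: real
  assumes "x \<in> \<nat>" "y \<in> \<nat>" "x < y"
  shows "nat \<lfloor>x\<rfloor> < nat \<lfloor>y\<rfloor>"
  using assms by (auto elim!: Nats_cases)

lemma scaleR_eq_iff_divide:
  "s \<noteq> 0 \<Longrightarrow> v = (a / s) *\<^sub>R x + (b / s) *\<^sub>R y \<longleftrightarrow> s *\<^sub>R v = a *\<^sub>R x + b *\<^sub>R (y :: 'v::real_vector)"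
proof -
  assume s: "s \<noteq> 0"
  have "v = (a / s) *\<^sub>R x + (b / s) *\<^sub>R y \<longleftrightarrow> s *\<^sub>R v = s *\<^sub>R ((a / s) *\<^sub>R x + (b / s) *\<^sub>R y)"
    using s by simp
  then show ?thesis using s by (simp add: scaleR_add_right)
qed

text \<open>What the finite and the affine case share. \<open>pr\<close> is the identity in the
  former; in the latter it is the projection that kills \<delta>, so that the form is positive
  definite on its values. \<open>diff_root\<close> and \<open>sum_root\<close> leave out equal and
  opposite projections because there the result is imaginary. \<open>ht\<close> is a height to
  induct on.\<close>

locale root_cone =
  fixes P D :: "'v::real_vector set" and pr :: "'v \<Rightarrow> 'a::real_inner" and ht :: "'v \<Rightarrow> real"
  assumes linear_pr: "linear pr" and linear_ht: "linear ht"
    and P_cone: "P \<subseteq> span_plus D"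
    and ht_nat: "x \<in> P \<Longrightarrow> ht x \<in> \<nat>"
    and ht_pos: "v \<in> span_plus D \<Longrightarrow> v \<noteq> 0 \<Longrightarrow> ht v > 0"
    and pr_nz: "x \<in> P \<Longrightarrow> pr x \<noteq> 0"
    and cartan: "x \<in> P \<Longrightarrow> y \<in> P \<Longrightarrow> 2 * (pr x \<bullet> pr y) / (pr y \<bullet> pr y) \<in> \<int>"
    and diff_root: "x \<in> P \<Longrightarrow> y \<in> P \<Longrightarrow> pr x \<bullet> pr y > 0 \<Longrightarrow> pr x \<noteq> pr y \<Longrightarrow> x - y \<in> P \<or> y - x \<in> P"
    and sum_root: "x \<in> P \<Longrightarrow> y \<in> P \<Longrightarrow> pr x \<bullet> pr y < 0 \<Longrightarrow> pr x \<noteq> - pr y \<Longrightarrow> x + y \<in> P"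
    and reduced: "x \<in> P \<Longrightarrow> y \<in> P \<Longrightarrow> pr x = c *\<^sub>R pr y \<Longrightarrow> c = 1 \<or> c = -1"
begin

lemmas pr_simps = linear_add[OF linear_pr] linear_diff[OF linear_pr] linear_scale[OF linear_pr]
lemmas ht_simps = linear_add[OF linear_ht] linear_diff[OF linear_ht] linear_scale[OF linear_ht]

lemma ht_root_pos: "x \<in> P \<Longrightarrow> ht x > 0"
  using ht_pos[of x] P_cone pr_nz[of x] linear_0[OF linear_pr] by force

lemma root_multiple: "x \<in> P \<Longrightarrow> y \<in> P \<Longrightarrow> x = c *\<^sub>R y \<Longrightarrow> x = y"
proof -
  assume xy: "x \<in> P" "y \<in> P" "x = c *\<^sub>R y"
  then have "c = 1 \<or> c = -1" using reduced[of x y c] by (simp add: pr_simps)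
  moreover have "c \<noteq> -1" using xy ht_root_pos[of x] ht_root_pos[of y] by (auto simp: ht_simps)
  ultimately show ?thesis using xy by simp
qed

text \<open>Closure under \<open>triple\<close> turns out to be equivalent to closure under \<open>span_plus\<close>, inside an
  order ideal and for a set and its complement simultaneously. A largest root occurs in
  the first kind of triple only as the sum, which makes adding it to the ideal easy. In the affine
  case the second kind of triple lives in a plane through the imaginary roots; in the finite case
  it is trivial.\<close>
definition deg_triple :: "'v \<Rightarrow> 'v \<Rightarrow> 'v \<Rightarrow> bool" where
  "deg_triple \<gamma> \<alpha> \<beta> \<longleftrightarrow> (\<exists>a>0. \<exists>b>0. \<gamma> = a *\<^sub>R \<alpha> + b *\<^sub>R \<beta>) \<and> (pr \<alpha> = pr \<gamma> \<or> pr \<alpha> = - pr \<gamma>)"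

definition triple :: "'v \<Rightarrow> 'v \<Rightarrow> 'v \<Rightarrow> bool" where
  "triple \<gamma> \<alpha> \<beta> \<longleftrightarrow> \<gamma> = \<alpha> + \<beta> \<or> deg_triple \<gamma> \<alpha> \<beta>"

definition triple_closed :: "'v set \<Rightarrow> 'v set \<Rightarrow> bool" where
  "triple_closed J X \<longleftrightarrow> (\<forall>\<alpha>\<in>X. \<forall>\<beta>\<in>X. \<forall>\<gamma>\<in>J. triple \<gamma> \<alpha> \<beta> \<longrightarrow> \<gamma> \<in> X)"

text \<open>Biclosedness with the complement \<open>Y\<close> made explicit, so that every argument
  can be reused with the blocks exchanged.\<close>

definition bipartition :: "'v set \<Rightarrow> 'v set \<Rightarrow> 'v set \<Rightarrow> bool" where
  "bipartition J X Y \<longleftrightarrow> X \<union> Y = J \<and> X \<inter> Y = {} \<and> triple_closed J X \<and> triple_closed J Y"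

definition ideal :: "'v set \<Rightarrow> bool" where
  "ideal J \<longleftrightarrow> J \<subseteq> P \<and> (\<forall>\<beta>\<in>J. \<forall>\<alpha>\<in>P. root_le D \<alpha> \<beta> \<longrightarrow> \<alpha> \<in> J)"

lemma partition_swap: "bipartition J X Y \<Longrightarrow> bipartition J Y X"
  unfolding bipartition_def by blast

lemma ideal_summand: "ideal J \<Longrightarrow> x \<in> P \<Longrightarrow> y \<in> P \<Longrightarrow> x + y \<in> J \<Longrightarrow> x \<in> J"
  unfolding ideal_def root_le_def using P_cone by (metis add_diff_cancel_left' in_mono)

lemma ideal_summand': "ideal J \<Longrightarrow> x \<in> P \<Longrightarrow> y \<in> P \<Longrightarrow> x + y \<in> J \<Longrightarrow> y \<in> J"
  using ideal_summand[of J y x] by (simp add: add.commute)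

lemma partition_sum:
  "bipartition J X Y \<Longrightarrow> \<alpha> \<in> X \<Longrightarrow> \<beta> \<in> X \<Longrightarrow> \<alpha> + \<beta> \<in> J \<Longrightarrow> \<alpha> + \<beta> \<in> X"
  unfolding bipartition_def triple_closed_def triple_def by blast

text \<open>The linear relation makes \<open>pr \<beta>\<close> proportional to
  \<open>pr \<gamma>\<close> as well, and reducedness turns the factor into a sign.\<close>

lemma deg_triple_swap:
  assumes "\<alpha> \<in> P" "\<beta> \<in> P" "\<gamma> \<in> P" "deg_triple \<gamma> \<alpha> \<beta>"
  shows "deg_triple \<gamma> \<beta> \<alpha>"
proof -
  obtain a b where ab: "a > 0" "b > 0" "\<gamma> = a *\<^sub>R \<alpha> + b *\<^sub>R \<beta>" and pr: "pr \<alpha> = pr \<gamma> \<or> pr \<alpha> = - pr \<gamma>"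
    using assms(4) unfolding deg_triple_def by blast
  have "\<exists>c. pr \<alpha> = c *\<^sub>R pr \<gamma>" using pr by (metis scaleR_minus1_left scaleR_one)
  then obtain c where c: "pr \<alpha> = c *\<^sub>R pr \<gamma>" by blast
  have "b *\<^sub>R pr \<beta> = pr \<gamma> - a *\<^sub>R pr \<alpha>" by (simp add: ab(3) pr_simps)
  then have "b *\<^sub>R pr \<beta> = (1 - a * c) *\<^sub>R pr \<gamma>" using c by (simp add: scaleR_diff_left)
  then have "pr \<beta> = ((1 - a * c) / b) *\<^sub>R pr \<gamma>" using ab(2)
    by (metis divide_inverse_commute less_irrefl real_vector_affinity_eq scaleR_scaleR vector_fraction_eq_iff)
  then have "pr \<beta> = pr \<gamma> \<or> pr \<beta> = - pr \<gamma>"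
    using reduced[OF assms(2,3)] by (metis scaleR_minus1_left scaleR_one)
  then show ?thesis unfolding deg_triple_def using ab by (metis add.commute)
qed

text \<open>Induction on the total height of the three roots. If \<gamma> were in \<open>Y\<close>,
  then (\<gamma>,\<gamma>) > 0 makes \<gamma> positive against \<alpha> or \<beta>. If against both,
  \<alpha> is a positive combination of \<gamma> - \<alpha> and \<gamma> - \<beta>, which lie in
  \<open>Y\<close>, and the induction hypothesis with the blocks exchanged puts \<alpha> into
  \<open>Y\<close>. If against only one, the G_2 configuration arises and adding roots
  suffices.\<close>

lemma partition_closed_aux:
  assumes J: "ideal J" and part: "bipartition J X Y"
    and "\<gamma> \<in> J" "\<alpha> \<in> X" "\<beta> \<in> X" "a > 0" "b > 0" "\<gamma> = a *\<^sub>R \<alpha> + b *\<^sub>R \<beta>"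
  shows "\<gamma> \<in> X"
  using assms(2-)
proof (induction "nat \<lfloor>ht \<gamma> + ht \<alpha> + ht \<beta>\<rfloor>" arbitrary: \<gamma> \<alpha> \<beta> a b X Y rule: less_induct)
  case less
  have JP: "J \<subseteq> P" using J by (simp add: ideal_def)
  have XY: "X \<union> Y = J" "X \<inter> Y = {}" using less.prems(1) by (auto simp: bipartition_def)
  have P: "\<alpha> \<in> P" "\<beta> \<in> P" "\<gamma> \<in> P" using less.prems XY JP by auto
  have IH: "\<gamma>' \<in> X'" if "bipartition J X' Y'" "\<gamma>' \<in> J" "\<alpha>' \<in> X'" "\<beta>' \<in> X'"
    "a' > 0" "b' > 0" "\<gamma>' = a' *\<^sub>R \<alpha>' + b' *\<^sub>R \<beta>'"
    "ht \<gamma>' + ht \<alpha>' + ht \<beta>' < ht \<gamma> + ht \<alpha> + ht \<beta>" for X' Y' \<alpha>' \<beta>' \<gamma>' a' b'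
  proof -
    have "X' \<subseteq> J" using that(1) by (auto simp: bipartition_def)
    then have P': "\<alpha>' \<in> P" "\<beta>' \<in> P" "\<gamma>' \<in> P" using that JP by auto
    have "nat \<lfloor>ht \<gamma>' + ht \<alpha>' + ht \<beta>'\<rfloor> < nat \<lfloor>ht \<gamma> + ht \<alpha> + ht \<beta>\<rfloor>"
      using that(8) P P' by (intro nat_floor_less Nats_add ht_nat)
    from less.hyps[OF this that(1-7)] show ?thesis .
  qed
  show ?case
  proof (rule ccontr)
    assume "\<gamma> \<notin> X"
    then have gY: "\<gamma> \<in> Y" using less.prems XY by auto
    \<comment> \<open>Proportional projections make the triple degenerate by reducedness, and
      closure under degenerate triples is given.\<close>
    have notdeg: False if "\<alpha> \<in> X" "\<beta> \<in> X" "a > 0" "b > 0" "\<gamma> = a *\<^sub>R \<alpha> + b *\<^sub>R \<beta>" "pr \<alpha> = c *\<^sub>R pr \<gamma>"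
      for \<alpha> \<beta> a b c
    proof -
      have "c = 1 \<or> c = -1" using reduced[OF _ P(3) that(6)] that XY JP by auto
      then have "deg_triple \<gamma> \<alpha> \<beta>" unfolding deg_triple_def using that by auto
      then show False using less.prems(1,2) that gY XY
        unfolding bipartition_def triple_closed_def triple_def by blast
    qed
    \<comment> \<open>\<gamma> and \<alpha>' differ by a root. Were \<alpha>' - \<gamma> positive,
      it would lie in \<open>X\<close>, and trading \<alpha>' for it would give a smaller instance.
      So \<gamma> - \<alpha>' is positive and not in \<open>X\<close>; for a' \<ge> 1 it would
      itself be a nonnegative combination of \<alpha>' and \<beta>', hence in
      \<open>X\<close>.\<close>
    have step: "\<gamma> - \<alpha>' \<in> Y \<and> a' < 1"
      if h: "\<alpha>' \<in> X" "\<beta>' \<in> X" "a' > 0" "b' > 0" "\<gamma> = a' *\<^sub>R \<alpha>' + b' *\<^sub>R \<beta>'"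
        and sum: "ht \<alpha>' + ht \<beta>' = ht \<alpha> + ht \<beta>" and pos: "pr \<gamma> \<bullet> pr \<alpha>' > 0"
      for \<alpha>' \<beta>' a' b'
    proof -
      have P': "\<alpha>' \<in> P" "\<beta>' \<in> P" using h XY JP by auto
      note hts = ht_root_pos[OF P'(1)] ht_root_pos[OF P'(2)] ht_root_pos[OF P(3)]
      have htg: "ht \<gamma> = a' * ht \<alpha>' + b' * ht \<beta>'" by (simp add: h(5) ht_simps)
      have "pr \<gamma> \<noteq> pr \<alpha>'" using notdeg[OF h, of 1] by auto
      then have "\<gamma> - \<alpha>' \<in> P \<or> \<alpha>' - \<gamma> \<in> P" using diff_root[OF P(3) P'(1) pos] by blast
      then show ?thesis
      proof
        assume r: "\<alpha>' - \<gamma> \<in> P"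
        define \<rho> where "\<rho> = \<alpha>' - \<gamma>"
        have rP: "\<rho> \<in> P" and al: "\<alpha>' = \<gamma> + \<rho>" using r by (auto simp: \<rho>_def)
        have aJ: "\<alpha>' \<in> J" using h(1) XY by auto
        have rJ: "\<rho> \<in> J" using ideal_summand'[OF J P(3) rP] aJ al by simp
        have rX: "\<rho> \<in> X"
        proof (rule ccontr)
          assume "\<rho> \<notin> X"
          then have "\<rho> \<in> Y" using rJ XY by auto
          then have "\<alpha>' \<in> Y" using partition_sum[OF partition_swap[OF less.prems(1)] gY] aJ al by simp
          then show False using h(1) XY by auto
        qed
        have htr: "ht \<alpha>' = ht \<gamma> + ht \<rho>" by (simp add: al ht_simps)
        have a1: "a' < 1"
        proof (rule ccontr)
          assume "\<not> a' < 1"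
          then have "a' * ht \<alpha>' \<ge> 1 * ht \<alpha>'" using hts by (intro mult_right_mono) auto
          moreover have "b' * ht \<beta>' > 0" using hts h(4) by simp
          ultimately show False using htg htr ht_root_pos[OF rP] by linarith
        qed
        have "(1 - a') *\<^sub>R \<gamma> = a' *\<^sub>R \<rho> + b' *\<^sub>R \<beta>'"
        proof -
          have "a' *\<^sub>R \<rho> + b' *\<^sub>R \<beta>' = a' *\<^sub>R \<alpha>' + b' *\<^sub>R \<beta>' - a' *\<^sub>R \<gamma>"
            by (simp add: \<rho>_def scaleR_diff_right)
          then show ?thesis using h(5) by (simp add: scaleR_diff_left)
        qed
        then have "\<gamma> = (a' / (1 - a')) *\<^sub>R \<rho> + (b' / (1 - a')) *\<^sub>R \<beta>'"
          using a1 by (simp add: scaleR_eq_iff_divide)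
        then have "\<gamma> \<in> X"
          using IH[OF less.prems(1,2) rX h(2), of "a' / (1 - a')" "b' / (1 - a')"] a1 h htr hts sum by auto
        then show ?thesis using \<open>\<gamma> \<notin> X\<close> by simp
      next
        assume r: "\<gamma> - \<alpha>' \<in> P"
        define \<rho> where "\<rho> = \<gamma> - \<alpha>'"
        have rP: "\<rho> \<in> P" and ga: "\<gamma> = \<alpha>' + \<rho>" using r by (auto simp: \<rho>_def)
        have rJ: "\<rho> \<in> J" using ideal_summand'[OF J P'(1) rP] less.prems(2) ga by simp
        have rX: "\<rho> \<notin> X"
          using partition_sum[OF less.prems(1) h(1)] less.prems(2) ga \<open>\<gamma> \<notin> X\<close> by auto
        have req: "\<rho> = (a' - 1) *\<^sub>R \<alpha>' + b' *\<^sub>R \<beta>'"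
        proof -
          have "\<rho> = a' *\<^sub>R \<alpha>' + b' *\<^sub>R \<beta>' - \<alpha>'" using h(5) by (simp add: \<rho>_def)
          then show ?thesis by (simp add: scaleR_diff_left)
        qed
        have htr: "ht \<gamma> = ht \<alpha>' + ht \<rho>" by (simp add: ga ht_simps)
        have "a' < 1"
        proof (rule ccontr)
          assume "\<not> a' < 1"
          then consider "a' = 1" | "a' > 1" by linarith
          then show False
          proof cases
            case 1
            then have "\<rho> = \<beta>'" using root_multiple[OF rP P'(2), of b'] req by simp
            then show False using rX h by simp
          next
            case 2
            then have "\<rho> \<in> X"
              using IH[OF less.prems(1) rJ h(1,2) _ h(4) req] htr hts sum by auto
            then show False using rX by simp
          qed
        qed
        then show ?thesis using rJ rX XY by (auto simp: \<rho>_def)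
      qed
    qed
    \<comment> \<open>Here \<beta>' = \<gamma> + 2 (\<gamma> - \<alpha>') with \<gamma> and \<gamma>
      - \<alpha>' in \<open>Y\<close>. The intermediate vector 2 \<gamma> - \<alpha>' is a root, so
      two additions put \<beta>' into \<open>Y\<close>.\<close>
    have G2: False
      if h: "\<alpha>' \<in> X" "\<beta>' \<in> X" "a' > 0" "b' > 0" "\<gamma> = a' *\<^sub>R \<alpha>' + b' *\<^sub>R \<beta>'"
        and sum: "ht \<alpha>' + ht \<beta>' = ht \<alpha> + ht \<beta>"
        and pos: "pr \<gamma> \<bullet> pr \<alpha>' > 0" and neg: "pr \<gamma> \<bullet> pr \<beta>' \<le> 0"
      for \<alpha>' \<beta>' a' b'
    proof -
      have P': "\<alpha>' \<in> P" "\<beta>' \<in> P" using h XY JP by auto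
      have rY: "\<gamma> - \<alpha>' \<in> Y" and a1: "a' < 1" using step[OF h sum pos] by auto
      then have rP: "\<gamma> - \<alpha>' \<in> P" using XY JP by auto
      have ind: "pr \<gamma> \<noteq> c *\<^sub>R pr \<alpha>'" for c
      proof
        assume eq: "pr \<gamma> = c *\<^sub>R pr \<alpha>'"
        then have "c = 1 \<or> c = -1" using reduced[OF P(3) P'(1)] by blast
        then have "pr \<alpha>' = c *\<^sub>R pr \<gamma>" using eq by auto
        then show False using notdeg[OF h] by blast
      qed
      have eq: "pr \<gamma> = a' *\<^sub>R pr \<alpha>' + b' *\<^sub>R pr \<beta>'" by (subst h(5)) (simp add: pr_simps)
      note c = G2_coefficients[OF eq h(3) a1 h(4) pr_nz[OF P(3)] pr_nz[OF P'(1)] pr_nz[OF P'(2)] ind pos neg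
          cartan[OF P(3) P'(1)] cartan[OF P'(1) P(3)] cartan[OF P'(2) P(3)] cartan[OF P(3) P'(2)]
          cartan[OF P'(1,2)] cartan[OF P'(2,1)]]
      have beta: "\<beta>' = (\<gamma> + (\<gamma> - \<alpha>')) + (\<gamma> - \<alpha>')"
      proof -
        have "3 *\<^sub>R \<gamma> = 2 *\<^sub>R \<alpha>' + \<beta>'" by (subst h(5)) (simp add: c scaleR_add_right)
        then have "\<beta>' = 3 *\<^sub>R \<gamma> - 2 *\<^sub>R \<alpha>'" by (simp add: algebra_simps)
        also have "\<dots> = (2 + 1) *\<^sub>R \<gamma> - (1 + 1) *\<^sub>R \<alpha>'" by simp
        also have "\<dots> = (\<gamma> + (\<gamma> - \<alpha>')) + (\<gamma> - \<alpha>')"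
          unfolding scaleR_add_left scaleR_one scaleR_2 by (simp add: algebra_simps)
        finally show ?thesis .
      qed
      have bJ: "\<beta>' \<in> J" using h XY by auto
      have "\<gamma> + (\<gamma> - \<alpha>') \<in> P"
      proof (rule sum_root[OF P(3) rP])
        show "pr \<gamma> \<bullet> pr (\<gamma> - \<alpha>') < 0" using c(3) by (simp add: pr_simps)
        show "pr \<gamma> \<noteq> - pr (\<gamma> - \<alpha>')"
        proof
          assume "pr \<gamma> = - pr (\<gamma> - \<alpha>')"
          then have "pr \<gamma> + pr \<gamma> = pr \<alpha>'" by (simp add: pr_simps algebra_simps)
          then have "2 *\<^sub>R pr \<gamma> = pr \<alpha>'" by (simp add: scaleR_2)
          then show False using notdeg[OF h, of 2] by simp
        qed
      qed
      then have "\<gamma> + (\<gamma> - \<alpha>') \<in> J"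
        using ideal_summand[OF J _ rP] bJ beta by simp
      then have "\<gamma> + (\<gamma> - \<alpha>') \<in> Y"
        using partition_sum[OF partition_swap[OF less.prems(1)] gY rY] by blast
      then have "\<beta>' \<in> Y"
        using partition_sum[OF partition_swap[OF less.prems(1)] _ rY] bJ beta by metis
      then show False using h XY by auto
    qed
    note ab = less.prems(3-6) less.prems(7)
    have ba: "\<gamma> = b *\<^sub>R \<beta> + a *\<^sub>R \<alpha>" using ab(5) by simp
    have sumc: "ht \<beta> + ht \<alpha> = ht \<alpha> + ht \<beta>" by simp
    consider "pr \<gamma> \<bullet> pr \<alpha> > 0" "pr \<gamma> \<bullet> pr \<beta> > 0" | "pr \<gamma> \<bullet> pr \<alpha> > 0" "pr \<gamma> \<bullet> pr \<beta> \<le> 0"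
      | "pr \<gamma> \<bullet> pr \<alpha> \<le> 0" "pr \<gamma> \<bullet> pr \<beta> > 0" | "pr \<gamma> \<bullet> pr \<alpha> \<le> 0" "pr \<gamma> \<bullet> pr \<beta> \<le> 0"
      by linarith
    then show False
    proof cases
      case 1
      define \<rho> where "\<rho> = \<gamma> - \<alpha>"
      define \<sigma> where "\<sigma> = \<gamma> - \<beta>"
      have Y: "\<rho> \<in> Y" "\<sigma> \<in> Y" and a1: "a < 1" and b1: "b < 1"
        using step[OF ab refl 1(1)] step[OF ab(2,1,4,3) ba sumc 1(2)] by (auto simp: \<rho>_def \<sigma>_def)
      then have YP: "\<rho> \<in> P" "\<sigma> \<in> P" using XY JP by auto
      note hts = ht_root_pos[OF P(1)] ht_root_pos[OF P(2)] ht_root_pos[OF P(3)] ht_root_pos[OF YP(1)] ht_root_pos[OF YP(2)]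
      \<comment> \<open>This eliminates \<beta> from \<gamma> = a \<alpha> + b \<beta>. The right
        side has positive height because b < 1, which makes a + b - 1 positive.\<close>
      have rel: "(a + b - 1) *\<^sub>R \<alpha> = (1 - b) *\<^sub>R \<rho> + b *\<^sub>R \<sigma>"
      proof -
        have "(1 - b) *\<^sub>R \<rho> + b *\<^sub>R \<sigma> = \<gamma> - b *\<^sub>R \<beta> - (1 - b) *\<^sub>R \<alpha>"
          by (simp add: \<rho>_def \<sigma>_def algebra_simps)
        also have "\<dots> = a *\<^sub>R \<alpha> - (1 - b) *\<^sub>R \<alpha>" by (subst ab(5)) simp
        finally show ?thesis by (simp add: algebra_simps)
      qed
      have "(a + b - 1) * ht \<alpha> = (1 - b) * ht \<rho> + b * ht \<sigma>"
        using arg_cong[OF rel, of ht] by (simp add: ht_simps)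
      moreover have "(1 - b) * ht \<rho> + b * ht \<sigma> > 0" using hts b1 ab(4) by (simp add: add_pos_pos)
      ultimately have "(a + b - 1) * ht \<alpha> > 0" by linarith
      then have s: "a + b - 1 > 0" using hts(1) by (rule zero_less_mult_pos2)
      have "\<alpha> = ((1 - b) / (a + b - 1)) *\<^sub>R \<rho> + (b / (a + b - 1)) *\<^sub>R \<sigma>"
        using rel s by (simp add: scaleR_eq_iff_divide)
      \<comment> \<open>The new total is 2 ht \<gamma> - ht \<beta>, and ht \<gamma> < ht \<alpha> +
        ht \<beta> since both coefficients are below 1.\<close>
      moreover have "ht \<alpha> + ht \<rho> + ht \<sigma> < ht \<gamma> + ht \<alpha> + ht \<beta>"
      proof -
        have "a * ht \<alpha> < 1 * ht \<alpha>" "b * ht \<beta> < 1 * ht \<beta>" using a1 b1 hts by (simp_all)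
        moreover have "ht \<gamma> = a * ht \<alpha> + b * ht \<beta>" by (subst ab(5)) (simp add: ht_simps)
        ultimately show ?thesis unfolding \<rho>_def \<sigma>_def ht_simps using hts(1,2) by linarith
      qed
      ultimately have "\<alpha> \<in> Y"
        using IH[OF partition_swap[OF less.prems(1)] _ Y, of \<alpha> "(1 - b) / (a + b - 1)" "b / (a + b - 1)"]
          s b1 ab XY by auto
      then show False using ab XY by auto
    next
      case 2
      then show False using G2[OF ab refl] by blast
    next
      case 3
      then show False using G2[OF ab(2,1,4,3) ba sumc] by blast
    next
      case 4
      have "pr \<gamma> \<bullet> pr \<gamma> = a * (pr \<gamma> \<bullet> pr \<alpha>) + b * (pr \<gamma> \<bullet> pr \<beta>)"
        by (subst (2) ab(5)) (simp add: pr_simps inner_add_right)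
      also have "\<dots> \<le> 0" using 4 ab by (simp add: mult_nonneg_nonpos add_nonpos_nonpos)
      finally show False using pr_nz[OF P(3)] inner_gt_zero_iff[of "pr \<gamma>"] by linarith
    qed
  qed
qed
section \<open>Extension of biclosed sets\<close>


lemma partition_closed:
  assumes J: "ideal J" and part: "bipartition J X Y"
  shows "closed_in_set J X"
  unfolding closed_in_set_def
proof (intro ballI)
  fix \<alpha> \<beta> \<gamma> assume h: "\<alpha> \<in> X" "\<beta> \<in> X" "\<gamma> \<in> span_plus {\<alpha>, \<beta>} \<inter> J"
  then obtain a b where ab: "a \<ge> 0" "b \<ge> 0" "\<gamma> = a *\<^sub>R \<alpha> + b *\<^sub>R \<beta>" and gJ: "\<gamma> \<in> J"
    using span_plus_pair[of \<gamma> \<alpha> \<beta>] by auto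
  have P: "\<alpha> \<in> P" "\<beta> \<in> P" "\<gamma> \<in> P"
    using h gJ J part by (auto simp: bipartition_def ideal_def)
  consider "a = 0" | "b = 0" | "a > 0" "b > 0" using ab by linarith
  then show "\<gamma> \<in> X"
  proof cases
    case 1
    then show ?thesis using root_multiple[OF P(3,2), of b] ab h by simp
  next
    case 2
    then show ?thesis using root_multiple[OF P(3,1), of a] ab h by simp
  next
    case 3
    then show ?thesis using partition_closed_aux[OF J part gJ h(1,2)] ab by blast
  qed
qed

lemma closed_triple_closed:
  assumes "closed_in_set J X" shows "triple_closed J X"
  unfolding triple_closed_def
proof (intro ballI impI)
  fix \<alpha> \<beta> \<gamma> assume h: "\<alpha> \<in> X" "\<beta> \<in> X" "\<gamma> \<in> J" "triple \<gamma> \<alpha> \<beta>"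
  from h(4) have "\<gamma> \<in> span_plus {\<alpha>, \<beta>}"
    unfolding triple_def deg_triple_def span_plus_pair
    by (metis less_imp_le scaleR_one zero_le_one)
  then show "\<gamma> \<in> X" using h assms unfolding closed_in_set_def by blast
qed

lemma partition_of_biclosed:
  "biclosed_in J X \<Longrightarrow> bipartition J X (J - X)"
  unfolding biclosed_in_def coclosed_in_set_def bipartition_def
  using closed_triple_closed[of J X] closed_triple_closed[of J "J - X"] by blast

lemma partition_biclosed:
  assumes "ideal J" "bipartition J X Y" shows "biclosed_in J X"
proof -
  have "Y = J - X" "X \<subseteq> J" using assms(2) unfolding bipartition_def by auto
  then show ?thesis using partition_closed[OF assms] partition_closed[OF assms(1) partition_swap[OF assms(2)]]
    unfolding biclosed_in_def coclosed_in_set_def by blast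
qed

section \<open>Adding a single root to an ideal\<close>

definition frontier_root :: "'v set \<Rightarrow> 'v \<Rightarrow> bool" where
  "frontier_root J \<beta> \<longleftrightarrow> ideal J \<and> \<beta> \<in> P \<and> \<beta> \<notin> J \<and>
     (\<forall>\<alpha>\<in>P. root_le D \<alpha> \<beta> \<longrightarrow> \<alpha> = \<beta> \<or> \<alpha> \<in> J)"

definition forced :: "'v set \<Rightarrow> 'v \<Rightarrow> bool" where
  "forced X \<beta> \<longleftrightarrow> (\<exists>\<alpha>1\<in>X. \<exists>\<alpha>2\<in>X. triple \<beta> \<alpha>1 \<alpha>2)"

lemma frontier_root_exists:
  assumes J: "ideal J" "J \<noteq> P"
  shows "\<exists>\<beta>. frontier_root J \<beta>"
proof -
  have "\<exists>x. x \<in> P - J" using J by (auto simp: ideal_def)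
  then obtain x where "x \<in> P - J" by blast
  from ex_has_least_nat[of "\<lambda>x. x \<in> P - J", OF this, of "\<lambda>x. nat \<lfloor>ht x\<rfloor>"]
  obtain \<beta> where b: "\<beta> \<in> P - J" and min: "\<And>y. y \<in> P - J \<Longrightarrow> nat \<lfloor>ht \<beta>\<rfloor> \<le> nat \<lfloor>ht y\<rfloor>"
    by blast
  have "\<alpha> = \<beta> \<or> \<alpha> \<in> J" if "\<alpha> \<in> P" "root_le D \<alpha> \<beta>" for \<alpha>
  proof (rule ccontr)
    assume n: "\<not> (\<alpha> = \<beta> \<or> \<alpha> \<in> J)"
    then have "ht (\<beta> - \<alpha>) > 0" using ht_pos that by (auto simp: root_le_def)
    then have "nat \<lfloor>ht \<alpha>\<rfloor> < nat \<lfloor>ht \<beta>\<rfloor>" using that b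
      by (intro nat_floor_less ht_nat) (auto simp: ht_simps)
    then show False using min[of \<alpha>] n that(1) by (metis DiffI leD)
  qed
  then show ?thesis using b J unfolding frontier_root_def by blast
qed

lemma frontier_root_not_le:
  "frontier_root J \<beta> \<Longrightarrow> \<gamma> \<in> J \<Longrightarrow> \<not> root_le D \<beta> \<gamma>"
  unfolding frontier_root_def ideal_def by blast

lemma frontier_root_ideal:
  assumes "frontier_root J \<beta>" shows "ideal (insert \<beta> J)"
  using assms unfolding frontier_root_def ideal_def by blast

text \<open>Otherwise all four products (\<alpha>i, \<gamma>j) are nonpositive, since a positive one
  would yield a root as difference, which neither block can hold; but they add up to
  (\<beta>,\<beta>) > 0. Equal projections stay open here because the difference is then
  imaginary.\<close>

lemma sum_sum_same_projection:
  assumes F: "frontier_root J \<beta>" and part: "bipartition J X Y"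
    and X: "\<alpha>1 \<in> X" "\<alpha>2 \<in> X" "\<beta> = \<alpha>1 + \<alpha>2" and Y: "\<gamma>1 \<in> Y" "\<gamma>2 \<in> Y" "\<beta> = \<gamma>1 + \<gamma>2"
  shows "pr \<alpha>1 = pr \<gamma>1 \<or> pr \<alpha>1 = pr \<gamma>2 \<or> pr \<alpha>2 = pr \<gamma>1 \<or> pr \<alpha>2 = pr \<gamma>2"
proof (rule ccontr)
  assume n: "\<not> ?thesis"
  have J: "ideal J" and bP: "\<beta> \<in> P" using F by (auto simp: frontier_root_def)
  have XY: "X \<union> Y = J" "X \<inter> Y = {}" using part by (auto simp: bipartition_def)
  have JP: "J \<subseteq> P" using J by (simp add: ideal_def)
  have aux: False if part: "bipartition J X Y" and X: "\<alpha> \<in> X" "\<alpha>' \<in> X" "\<beta> = \<alpha> + \<alpha>'"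
      and Y: "\<gamma> \<in> Y" "\<gamma>' \<in> Y" "\<beta> = \<gamma> + \<gamma>'" and d: "\<alpha> - \<gamma> \<in> P" for X Y \<alpha> \<alpha>' \<gamma> \<gamma>'
  proof -
    have XY: "X \<union> Y = J" "X \<inter> Y = {}" using part by (auto simp: bipartition_def)
    have gP: "\<gamma> \<in> P" using Y XY JP by auto
    have "\<gamma> + (\<alpha> - \<gamma>) \<in> J" using X XY by auto
    then have dJ: "\<alpha> - \<gamma> \<in> J" using ideal_summand'[OF J gP d] by simp
    have e: "\<alpha>' + (\<alpha> - \<gamma>) = \<gamma>'" using X(3) Y(3) by (simp add: algebra_simps)
    show False
    proof (cases "\<alpha> - \<gamma> \<in> X")
      case True
      then have "\<alpha>' + (\<alpha> - \<gamma>) \<in> X" using partition_sum[OF part X(2)] e Y(2) XY(1) by auto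
      then show False using e Y(2) XY(2) by auto
    next
      case False
      then have "\<gamma> + (\<alpha> - \<gamma>) \<in> Y"
        using partition_sum[OF partition_swap[OF part] Y(1), of "\<alpha> - \<gamma>"] dJ X(1) XY by auto
      then show False using X(1) XY(2) by auto
    qed
  qed
  have aux2: "pr \<alpha> \<bullet> pr \<gamma> \<le> 0" if X: "\<alpha> \<in> X" "\<alpha>' \<in> X" "\<beta> = \<alpha> + \<alpha>'"
      and Y: "\<gamma> \<in> Y" "\<gamma>' \<in> Y" "\<beta> = \<gamma> + \<gamma>'" and ne: "pr \<alpha> \<noteq> pr \<gamma>" for \<alpha> \<alpha>' \<gamma> \<gamma>'
  proof (rule ccontr)
    assume "\<not> ?thesis"
    moreover have "\<alpha> \<in> P" "\<gamma> \<in> P" using X(1) Y(1) XY(1) JP by blast+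
    ultimately have "\<alpha> - \<gamma> \<in> P \<or> \<gamma> - \<alpha> \<in> P" using diff_root[of \<alpha> \<gamma>] ne by simp
    then show False using aux[OF part X Y] aux[OF partition_swap[OF part] Y X] by blast
  qed
  have X': "\<beta> = \<alpha>2 + \<alpha>1" and Y': "\<beta> = \<gamma>2 + \<gamma>1" using X Y by (auto simp: add.commute)
  have "pr \<beta> \<bullet> pr \<beta> = (pr \<alpha>1 + pr \<alpha>2) \<bullet> (pr \<gamma>1 + pr \<gamma>2)"
    using X(3) Y(3) by (metis pr_simps(1))
  also have "\<dots> \<le> 0"
    using aux2[OF X Y] aux2[OF X Y(2,1) Y'] aux2[OF X(2,1) X' Y] aux2[OF X(2,1) X' Y(2,1) Y'] n
    by (simp add: inner_add_left inner_add_right)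
  finally show False using pr_nz[OF bP] inner_gt_zero_iff[of "pr \<beta>"] by linarith
qed

end

text \<open>The first assumption says that some block can accept \<beta> as a result of triples. The
  second treats \<beta> as an ingredient: if \<beta> in \<open>X\<close> would drag a root of
  \<open>Y\<close> over, then \<open>Y\<close> already forces \<beta>.\<close>

locale extendable_root_cone = root_cone P D pr ht
  for P D :: "'v::real_vector set" and pr :: "'v \<Rightarrow> 'a::real_inner" and ht :: "'v \<Rightarrow> real" +
  assumes not_both_forced:
      "frontier_root J \<beta> \<Longrightarrow> bipartition J X Y \<Longrightarrow> forced X \<beta> \<Longrightarrow> forced Y \<beta> \<Longrightarrow> False"
    and forced_of_deg_triple:
      "frontier_root J \<beta> \<Longrightarrow> bipartition J X Y \<Longrightarrow> \<alpha> \<in> X \<Longrightarrow> \<gamma> \<in> Y \<Longrightarrow> deg_triple \<gamma> \<beta> \<alpha> \<Longrightarrow> forced Y \<beta>"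
begin

text \<open>A violation in \<open>insert \<beta> X\<close> has \<beta> as an ingredient of some
  \<gamma> in \<open>Y\<close>. An ordinary sum would put \<beta> below \<gamma>, hence into the
  ideal; a degenerate triple would make \<open>Y\<close> force \<beta>.\<close>

lemma partition_insert_forced:
  assumes F: "frontier_root J \<beta>" and part: "bipartition J X Y"
    and nf: "\<not> forced Y \<beta>"
  shows "bipartition (insert \<beta> J) (insert \<beta> X) Y"
proof -
  have J: "ideal J" and bP: "\<beta> \<in> P" and bJ: "\<beta> \<notin> J" using F by (auto simp: frontier_root_def)
  have XY: "X \<union> Y = J" "X \<inter> Y = {}" and tc: "triple_closed J X" "triple_closed J Y"
    using part by (auto simp: bipartition_def)
  have JP: "J \<subseteq> P" using J by (simp add: ideal_def)
  have "triple_closed (insert \<beta> J) Y"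
    using tc(2) nf unfolding triple_closed_def forced_def by blast
  moreover have "triple_closed (insert \<beta> J) (insert \<beta> X)"
    unfolding triple_closed_def
  proof (intro ballI impI)
    fix \<alpha>1 \<alpha>2 \<gamma> assume h: "\<alpha>1 \<in> insert \<beta> X" "\<alpha>2 \<in> insert \<beta> X" "\<gamma> \<in> insert \<beta> J" "triple \<gamma> \<alpha>1 \<alpha>2"
    have P: "\<alpha>1 \<in> P" "\<alpha>2 \<in> P" "\<gamma> \<in> P" using h XY JP bP by auto
    show "\<gamma> \<in> insert \<beta> X"
    proof (rule ccontr)
      assume n: "\<gamma> \<notin> insert \<beta> X"
      then have gY: "\<gamma> \<in> Y" and gJ: "\<gamma> \<in> J" using h XY by auto
      have "\<alpha>1 = \<beta> \<or> \<alpha>2 = \<beta>" using n h tc(1) gJ unfolding triple_closed_def by blast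
      moreover have "\<gamma> \<noteq> \<alpha>1 + \<alpha>2"
      proof
        assume "\<gamma> = \<alpha>1 + \<alpha>2"
        then have "root_le D \<alpha>1 \<gamma>" "root_le D \<alpha>2 \<gamma>" using P P_cone by (auto simp: root_le_def)
        then show False using \<open>\<alpha>1 = \<beta> \<or> \<alpha>2 = \<beta>\<close> frontier_root_not_le[OF F gJ] by blast
      qed
      then have d: "deg_triple \<gamma> \<alpha>1 \<alpha>2" using h by (simp add: triple_def)
      ultimately obtain \<alpha> where a: "deg_triple \<gamma> \<beta> \<alpha>" "\<alpha> \<in> insert \<beta> X"
        using deg_triple_swap[OF P d] h by blast
      have "\<alpha> \<noteq> \<beta>"
      proof
        assume "\<alpha> = \<beta>"
        then obtain a b where "\<gamma> = a *\<^sub>R \<beta> + b *\<^sub>R \<beta>" using a(1) unfolding deg_triple_def by blast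
        then have "\<gamma> = (a + b) *\<^sub>R \<beta>" by (simp add: scaleR_add_left)
        then show False using root_multiple[OF P(3) bP] n by blast
      qed
      then show False using forced_of_deg_triple[OF F part _ gY a(1)] a(2) nf by blast
    qed
  qed
  ultimately show ?thesis unfolding bipartition_def using XY bJ by auto
qed

section \<open>Maximal partial extensions\<close>

text \<open>A partition of an ideal is encoded as a set of roots labelled \<open>True\<close> (first block)
  and \<open>False\<close> (second block), so that Zorn's lemma applies to set inclusion.\<close>
definition block :: "('v \<times> bool) set \<Rightarrow> bool \<Rightarrow> 'v set" where
  "block Z t = {v. (v, t) \<in> Z}"

lemma block_Union: "block (\<Union>Z) t = (\<Union>z\<in>Z. block z t)"
  by (auto simp: block_def)

text \<open>The last conjunct keeps the first block inside every biclosed extension, so that the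
  final set is least and not only minimal.\<close>

definition partial_ext :: "'v set \<Rightarrow> 'v set \<Rightarrow> ('v \<times> bool) set \<Rightarrow> bool" where
  "partial_ext I B Z \<longleftrightarrow> ideal (block Z True \<union> block Z False) \<and>
     bipartition (block Z True \<union> block Z False) (block Z True) (block Z False) \<and>
     B \<subseteq> block Z True \<and> I - B \<subseteq> block Z False \<and>
     (\<forall>C. biclosed_in P C \<and> C \<inter> I = B \<longrightarrow> block Z True \<subseteq> C)"

text \<open>A triple involves three labelled roots, and these already lie together in one member of
  the chain.\<close>

lemma triple_closed_chain:
  assumes c: "\<And>z z'. z \<in> Z \<Longrightarrow> z' \<in> Z \<Longrightarrow> z \<subseteq> z' \<or> z' \<subseteq> z"
    and t: "\<And>z. z \<in> Z \<Longrightarrow> bipartition (block z True \<union> block z False) (block z True) (block z False)"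
  shows "triple_closed (block (\<Union>Z) True \<union> block (\<Union>Z) False) (block (\<Union>Z) s)"
  unfolding triple_closed_def
proof (intro ballI impI)
  fix \<alpha> \<beta> \<gamma>
  assume h: "\<alpha> \<in> block (\<Union>Z) s" "\<beta> \<in> block (\<Union>Z) s" "\<gamma> \<in> block (\<Union>Z) True \<union> block (\<Union>Z) False"
    "triple \<gamma> \<alpha> \<beta>"
  obtain z1 z2 z3 u where z: "z1 \<in> Z" "z2 \<in> Z" "z3 \<in> Z" "(\<alpha>, s) \<in> z1" "(\<beta>, s) \<in> z2" "(\<gamma>, u) \<in> z3"
    using h by (auto simp: block_def)
  obtain z' where z': "z' \<in> Z" "z1 \<subseteq> z'" "z2 \<subseteq> z'"
    using c[OF z(1,2)] z(1,2) by (metis order_refl)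
  obtain z where "z \<in> Z" "z' \<subseteq> z" "z3 \<subseteq> z"
    using c[OF z'(1) z(3)] z'(1) z(3) by (metis order_refl)
  then have zz: "z \<in> Z" "(\<alpha>, s) \<in> z" "(\<beta>, s) \<in> z" "(\<gamma>, u) \<in> z" using z(4-6) z'(2,3) by blast+
  have "triple_closed (block z True \<union> block z False) (block z s)"
    using t[OF zz(1)] by (cases s) (simp_all add: bipartition_def)
  moreover have "\<gamma> \<in> block z True \<union> block z False" using zz(4) by (cases u) (simp_all add: block_def)
  moreover have "\<alpha> \<in> block z s" "\<beta> \<in> block z s" using zz by (simp_all add: block_def)
  ultimately have "\<gamma> \<in> block z s" using h(4) unfolding triple_closed_def by blast
  then show "\<gamma> \<in> block (\<Union>Z) s" using zz(1) by (auto simp: block_def)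
qed

lemma partial_ext_chain:
  assumes ne: "Z \<noteq> {}" and c: "\<And>z z'. z \<in> Z \<Longrightarrow> z' \<in> Z \<Longrightarrow> z \<subseteq> z' \<or> z' \<subseteq> z"
    and e: "\<And>z. z \<in> Z \<Longrightarrow> partial_ext I B z"
  shows "partial_ext I B (\<Union>Z)"
proof -
  have t: "bipartition (block z True \<union> block z False) (block z True) (block z False)" if "z \<in> Z" for z
    using e[OF that] by (simp add: partial_ext_def)
  have id: "ideal (block z True \<union> block z False)" if "z \<in> Z" for z
    using e[OF that] by (simp add: partial_ext_def)
  have "ideal (block (\<Union>Z) True \<union> block (\<Union>Z) False)"
    using id unfolding ideal_def block_Union by (auto; blast)
  moreover have "block (\<Union>Z) True \<inter> block (\<Union>Z) False = {}"
  proof -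
    have False if "(v, True) \<in> z" "(v, False) \<in> z'" "z \<in> Z" "z' \<in> Z" for v z z'
    proof -
      have "\<exists>z\<in>Z. (v, True) \<in> z \<and> (v, False) \<in> z" using c[OF that(3,4)] that by blast
      then show False using t unfolding bipartition_def block_def by blast
    qed
    then show ?thesis by (auto simp: block_def)
  qed
  moreover have "B \<subseteq> block (\<Union>Z) True" "I - B \<subseteq> block (\<Union>Z) False"
    using ne e unfolding partial_ext_def block_Union by blast+
  moreover have "block (\<Union>Z) True \<subseteq> C" if "biclosed_in P C" "C \<inter> I = B" for C
    using e that unfolding partial_ext_def block_Union by blast
  ultimately show ?thesis
    unfolding partial_ext_def bipartition_def using triple_closed_chain[OF c t] by blast
qed

text \<open>A maximal partial extension covers \<open>P\<close>, since otherwise a frontier root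
  could still be added. Zorn's lemma takes the place of induction because an affine system has
  infinitely many positive roots.\<close>

lemma least_biclosed_extension:
  assumes I: "ideal I" and B: "biclosed_in I B"
  shows "\<exists>X. biclosed_in P X \<and> X \<inter> I = B \<and> (\<forall>C. biclosed_in P C \<and> C \<inter> I = B \<longrightarrow> X \<subseteq> C)"
proof -
  let ?A = "{Z. partial_ext I B Z}"
  let ?J = "\<lambda>Z. block Z True \<union> block Z False"
  let ?Z0 = "B \<times> {True} \<union> (I - B) \<times> {False}"
  have B0: "block ?Z0 True = B" "block ?Z0 False = I - B" by (auto simp: block_def)
  have BI: "B \<union> (I - B) = I" using B by (auto simp: biclosed_in_def)
  have "?Z0 \<in> ?A" unfolding mem_Collect_eq partial_ext_def B0 BI
    using I partition_of_biclosed[OF B] by auto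
  then have "\<exists>M\<in>?A. \<forall>Z\<in>?A. M \<subseteq> Z \<longrightarrow> Z = M"
  proof (intro subset_Zorn_nonempty)
    fix \<C> assume "\<C> \<noteq> {}" "subset.chain ?A \<C>"
    then show "\<Union>\<C> \<in> ?A" using partial_ext_chain[of \<C> I B]
      unfolding subset_chain_def by blast
  qed blast
  then obtain M where M: "partial_ext I B M" and max: "\<And>Z. partial_ext I B Z \<Longrightarrow> M \<subseteq> Z \<Longrightarrow> Z = M"
    by blast
  define X Y where "X = block M True" and "Y = block M False"
  have id: "ideal (X \<union> Y)" and part: "bipartition (X \<union> Y) X Y" and BX: "B \<subseteq> X" and BY: "I - B \<subseteq> Y"
    and least: "\<And>C. biclosed_in P C \<Longrightarrow> C \<inter> I = B \<Longrightarrow> X \<subseteq> C"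
    using M unfolding partial_ext_def X_def Y_def by auto
  have "X \<union> Y = P"
  proof (rule ccontr)
    assume "X \<union> Y \<noteq> P"
    then obtain \<beta> where F: "frontier_root (X \<union> Y) \<beta>" using frontier_root_exists[OF id] by blast
    have bn: "\<beta> \<notin> X \<union> Y" "\<beta> \<in> P" using F by (auto simp: frontier_root_def)
    have id': "ideal (insert \<beta> (X \<union> Y))" using frontier_root_ideal[OF F] .
    have contra: False if "partial_ext I B (insert (\<beta>, t) M)" for t
    proof -
      have "(\<beta>, t) \<in> M" using max[OF that] by blast
      then show False using bn by (cases t) (auto simp: X_def Y_def block_def)
    qed
    show False
    proof (cases "forced X \<beta>")
      case True
      have b: "block (insert (\<beta>, True) M) True = insert \<beta> X" "block (insert (\<beta>, True) M) False = Y"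
        by (auto simp: block_def X_def Y_def)
      have "bipartition (insert \<beta> (X \<union> Y)) (insert \<beta> X) Y"
        using partition_insert_forced[OF F part] not_both_forced[OF F part True] by blast
      \<comment> \<open>Every competing \<open>C\<close> contains \<open>X\<close>, hence the two
        roots that force \<beta>, so the enlarged block still lies in \<open>C\<close>.\<close>
      moreover have "\<beta> \<in> C" if C: "biclosed_in P C" "C \<inter> I = B" for C
      proof -
        have "triple_closed P C" using partition_of_biclosed[OF C(1)] by (simp add: bipartition_def)
        then show ?thesis using True least[OF C] bn unfolding forced_def triple_closed_def by blast
      qed
      ultimately have "partial_ext I B (insert (\<beta>, True) M)"
        unfolding partial_ext_def b using id' BX BY least by auto
      then show False using contra by blast
    next
      case False
      have b: "block (insert (\<beta>, False) M) True = X" "block (insert (\<beta>, False) M) False = insert \<beta> Y"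
        by (auto simp: block_def X_def Y_def)
      have "bipartition (insert \<beta> (X \<union> Y)) X (insert \<beta> Y)"
        using partition_insert_forced[OF F partition_swap[OF part] False] partition_swap by blast
      then have "partial_ext I B (insert (\<beta>, False) M)"
        unfolding partial_ext_def b using id' BX BY least by auto
      then show False using contra by blast
    qed
  qed
  then have "biclosed_in P X" using partition_biclosed[OF id part] by simp
  moreover have "X \<inter> I = B"
    using BX BY part BI unfolding bipartition_def by blast
  ultimately show ?thesis using least by blast
qed

text \<open>A least extension lies inside every minimal one, and so is the only minimal one.\<close>

lemma extension_property:
  assumes "P = pos_roots \<Phi> D" shows "biclosed_extension_property \<Phi> D"
  unfolding biclosed_extension_property_def assms[symmetric]
proof (intro allI impI)
  fix I B assume h: "order_ideal \<Phi> D I \<and> biclosed_in I B"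
  then have "ideal I" unfolding order_ideal_def ideal_def using assms by blast
  then have "\<exists>X. biclosed_in P X \<and> X \<inter> I = B \<and> (\<forall>C. biclosed_in P C \<and> C \<inter> I = B \<longrightarrow> X \<subseteq> C)"
    using least_biclosed_extension h by simp
  then obtain X where X: "biclosed_in P X" "X \<inter> I = B"
      and least: "\<forall>C. biclosed_in P C \<and> C \<inter> I = B \<longrightarrow> X \<subseteq> C"
    by (elim exE conjE)
  show "\<exists>!Bb. biclosed_in P Bb \<and> Bb \<inter> I = B \<and>
      (\<forall>C. biclosed_in P C \<and> C \<inter> I = B \<and> C \<subseteq> Bb \<longrightarrow> C = Bb)"
  proof (rule ex1I[of _ X])
    show "biclosed_in P X \<and> X \<inter> I = B \<and>
        (\<forall>C. biclosed_in P C \<and> C \<inter> I = B \<and> C \<subseteq> X \<longrightarrow> C = X)"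
      using X least by (simp add: subset_antisym)
    show "Bb = X" if "biclosed_in P Bb \<and> Bb \<inter> I = B \<and>
        (\<forall>C. biclosed_in P C \<and> C \<inter> I = B \<and> C \<subseteq> Bb \<longrightarrow> C = Bb)" for Bb
      using that X least by metis
  qed
qed

end

section \<open>Finite root systems\<close>

lemma root_neg: "finite_root_system \<Phi> \<Longrightarrow> x \<in> \<Phi> \<Longrightarrow> - x \<in> \<Phi>"
proof -
  assume h: "finite_root_system \<Phi>" "x \<in> \<Phi>"
  then have "x - (2 * (x \<bullet> x) / (x \<bullet> x)) *\<^sub>R x \<in> \<Phi>" "x \<noteq> 0" unfolding finite_root_system_def by blast+
  then show ?thesis by (simp add: scaleR_2)
qed

lemma root_reduced:
  "finite_root_system \<Phi> \<Longrightarrow> x \<in> \<Phi> \<Longrightarrow> y \<in> \<Phi> \<Longrightarrow> x = c *\<^sub>R y \<Longrightarrow> c = 1 \<or> c = -1"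
  unfolding finite_root_system_def by blast

text \<open>The product of the two Cartan integers is 4 cos^2 of the angle, below 4 because the
  roots are not proportional. One of the integers is therefore 1, and the corresponding reflection
  yields x - y or y - x.\<close>

lemma root_diff:
  assumes R: "finite_root_system \<Phi>" and xy: "x \<in> \<Phi>" "y \<in> \<Phi>" "x \<bullet> y > 0" "x \<noteq> y"
  shows "x - y \<in> \<Phi>"
proof -
  define m where "m = 2 * (x \<bullet> y) / (y \<bullet> y)"
  define n where "n = 2 * (y \<bullet> x) / (x \<bullet> x)"
  have refl: "x - m *\<^sub>R y \<in> \<Phi>" "y - n *\<^sub>R x \<in> \<Phi>" and int: "m \<in> \<int>" "n \<in> \<int>"
    using R xy unfolding finite_root_system_def m_def n_def by blast+
  have nz: "x \<noteq> 0" "y \<noteq> 0" using xy by auto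
  have ind: "x \<noteq> c *\<^sub>R y" for c
  proof
    assume c: "x = c *\<^sub>R y"
    then consider "x = y" | "x = - y" using root_reduced[OF R xy(1,2) c] by auto
    then show False
    proof cases
      case 2
      then have "x \<bullet> y = - (y \<bullet> y)" by simp
      then show False using xy(3) inner_ge_zero[of y] by linarith
    qed (use xy in simp)
  qed
  have "m * n < 4"
    using Cauchy_Schwarz_strict[OF nz(2) ind] nz
    by (simp add: m_def n_def field_simps power2_eq_square inner_commute)
  moreover have "0 < m" "0 < n" using xy(3) nz by (auto simp: m_def n_def inner_commute)
  ultimately have "m = 1 \<or> n = 1" using cartan_product_cases int by blast
  then show ?thesis using refl root_neg[OF R, of "y - x"] by auto
qed

lemma root_sum:
  assumes R: "finite_root_system \<Phi>" and xy: "x \<in> \<Phi>" "y \<in> \<Phi>" "x \<bullet> y < 0" "x \<noteq> - y"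
  shows "x + y \<in> \<Phi>"
  using root_diff[OF R xy(1) root_neg[OF R xy(2)]] xy by auto

lemma span_plus_sum: "\<forall>v\<in>S. 0 \<le> c v \<Longrightarrow> (\<Sum>v\<in>S. c v *\<^sub>R v) \<in> span_plus S"
  unfolding span_plus_def by blast

lemma span_plus_scale: "0 \<le> r \<Longrightarrow> v \<in> span_plus S \<Longrightarrow> r *\<^sub>R v \<in> span_plus S"
proof -
  assume r: "0 \<le> r" and "v \<in> span_plus S"
  then obtain c where c: "\<forall>v\<in>S. 0 \<le> c v" "v = (\<Sum>v\<in>S. c v *\<^sub>R v)" unfolding span_plus_def by blast
  then have "r *\<^sub>R v = (\<Sum>v\<in>S. (r * c v) *\<^sub>R v)" by (simp add: scaleR_sum_right)
  then show ?thesis using span_plus_sum[of S "\<lambda>v. r * c v"] c(1) r by simp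
qed

lemma base_coefficients:
  assumes "is_base \<Phi> \<Delta>" "x \<in> \<Phi>"
  shows "\<exists>c :: 'a::euclidean_space \<Rightarrow> int. ((\<forall>\<alpha>\<in>\<Delta>. 0 \<le> c \<alpha>) \<or> (\<forall>\<alpha>\<in>\<Delta>. c \<alpha> \<le> 0)) \<and>
    x = (\<Sum>\<alpha>\<in>\<Delta>. of_int (c \<alpha>) *\<^sub>R \<alpha>)"
  using assms by (simp add: is_base_def)

lemma root_pos_or_neg:
  assumes "is_base \<Phi> \<Delta>" "x \<in> \<Phi>"
  shows "x \<in> span_plus \<Delta> \<or> - x \<in> span_plus \<Delta>"
proof -
  obtain c :: "'a \<Rightarrow> int" where c: "(\<forall>\<alpha>\<in>\<Delta>. 0 \<le> c \<alpha>) \<or> (\<forall>\<alpha>\<in>\<Delta>. c \<alpha> \<le> 0)"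
    and x: "x = (\<Sum>\<alpha>\<in>\<Delta>. of_int (c \<alpha>) *\<^sub>R \<alpha>)"
    using base_coefficients[OF assms] by (elim exE conjE)
  have "- x = (\<Sum>\<alpha>\<in>\<Delta>. of_int (- c \<alpha>) *\<^sub>R \<alpha>)" by (simp add: x sum_negf)
  then show ?thesis
    using c span_plus_sum[of \<Delta> "\<lambda>\<alpha>. of_int (c \<alpha>)"] span_plus_sum[of \<Delta> "\<lambda>\<alpha>. of_int (- c \<alpha>)"]
    by (auto simp flip: x)
qed

text \<open>The height will do: the linear function with value 1 on each base vector.\<close>

lemma base_height_exists:
  assumes "is_base \<Phi> \<Delta>"
  shows "\<exists>f. linear f \<and> (\<forall>x\<in>\<Phi>. f x \<in> (\<int> :: real set)) \<and> (\<forall>v\<in>span_plus \<Delta>. 0 \<le> f v \<and> (f v = 0 \<longrightarrow> v = 0))"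
proof -
  have ind: "independent \<Delta>" using assms by (simp add: is_base_def)
  then have fin: "finite \<Delta>" by (rule independent_imp_finite)
  obtain f where f: "linear f" "\<forall>x\<in>\<Delta>. f x = (1::real)"
    using linear_independent_extend[OF ind, of "\<lambda>_. 1"] by blast
  have fsum: "f (\<Sum>\<alpha>\<in>\<Delta>. c \<alpha> *\<^sub>R \<alpha>) = (\<Sum>\<alpha>\<in>\<Delta>. c \<alpha>)" for c
  proof -
    have "f (\<Sum>\<alpha>\<in>\<Delta>. c \<alpha> *\<^sub>R \<alpha>) = (\<Sum>\<alpha>\<in>\<Delta>. f (c \<alpha> *\<^sub>R \<alpha>))" by (rule linear_sum[OF f(1)])
    also have "\<dots> = (\<Sum>\<alpha>\<in>\<Delta>. c \<alpha>)" by (rule sum.cong) (use f(2) linear_scale[OF f(1)] in auto)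
    finally show ?thesis .
  qed
  have "f x \<in> \<int>" if xR: "x \<in> \<Phi>" for x
  proof -
    obtain c :: "'a \<Rightarrow> int" where x: "x = (\<Sum>\<alpha>\<in>\<Delta>. of_int (c \<alpha>) *\<^sub>R \<alpha>)"
      using base_coefficients[OF assms xR] by (elim exE conjE)
    have "f x = (\<Sum>\<alpha>\<in>\<Delta>. of_int (c \<alpha>))" unfolding x by (rule fsum)
    then show ?thesis by (simp flip: of_int_sum)
  qed
  moreover have "0 \<le> f v \<and> (f v = 0 \<longrightarrow> v = 0)" if vS: "v \<in> span_plus \<Delta>" for v
  proof -
    obtain c where c: "\<forall>v\<in>\<Delta>. 0 \<le> c v" "v = (\<Sum>v\<in>\<Delta>. c v *\<^sub>R v)" using vS unfolding span_plus_def by blast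
    have fv: "f v = (\<Sum>\<alpha>\<in>\<Delta>. c \<alpha>)" unfolding c(2) by (rule fsum)
    have "v = 0" if "f v = 0"
    proof -
      have "\<forall>v\<in>\<Delta>. c v = 0" using that c(1) fin unfolding fv by (simp add: sum_nonneg_eq_0_iff)
      then show ?thesis using c(2) by simp
    qed
    then show ?thesis using c(1) unfolding fv by (simp add: sum_nonneg)
  qed
  ultimately show ?thesis using f(1) by blast
qed

lemma Ints_nonneg_Nats: "x \<in> \<int> \<Longrightarrow> 0 \<le> x \<Longrightarrow> (x::real) \<in> \<nat>"
  by (auto elim!: Ints_cases simp: Nats_altdef2 Ints_def)

lemma finite_extension_property:
  fixes \<Phi> \<Delta> :: "'a::euclidean_space set"
  assumes R: "finite_root_system \<Phi>" and base: "is_base \<Phi> \<Delta>"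
  shows "biclosed_extension_property \<Phi> \<Delta>"
proof -
  from base_height_exists[OF base] obtain f :: "'a \<Rightarrow> real" where "linear f"
    "(\<forall>x\<in>\<Phi>. f x \<in> \<int>) \<and> (\<forall>v\<in>span_plus \<Delta>. 0 \<le> f v \<and> (f v = 0 \<longrightarrow> v = 0))"
    by (elim exE conjE) simp
  then have f: "linear f" "\<And>x. x \<in> \<Phi> \<Longrightarrow> f x \<in> \<int>"
    "\<And>v. v \<in> span_plus \<Delta> \<Longrightarrow> 0 \<le> f v" "\<And>v. v \<in> span_plus \<Delta> \<Longrightarrow> f v = 0 \<Longrightarrow> v = 0"
    by simp_all
  let ?P = "pos_roots \<Phi> \<Delta>"
  have P: "x \<in> \<Phi>" "x \<in> span_plus \<Delta>" if "x \<in> ?P" for x using that by (auto simp: pos_roots_def)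
  interpret root_cone ?P \<Delta> id f
  proof (rule root_cone.intro)
    show "linear (id :: 'a \<Rightarrow> 'a)" by (rule linear_id)
    show "linear f" by (fact f)
    show "?P \<subseteq> span_plus \<Delta>" using P by blast
    fix x y assume x: "x \<in> ?P"
    show "f x \<in> \<nat>" using f(2,3) P[OF x] by (intro Ints_nonneg_Nats) auto
    show "id x \<noteq> 0" using P[OF x] R by (auto simp: finite_root_system_def)
    assume y: "y \<in> ?P"
    show "2 * (id x \<bullet> id y) / (id y \<bullet> id y) \<in> \<int>"
      using P(1)[OF x] P(1)[OF y] R by (simp add: finite_root_system_def)
    show "x - y \<in> ?P \<or> y - x \<in> ?P" if "id x \<bullet> id y > 0" "id x \<noteq> id y"
      using root_diff[OF R, of x y] root_neg[OF R, of "x - y"] P(1)[OF x] P(1)[OF y]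
        root_pos_or_neg[OF base, of "x - y"] that by (auto simp: pos_roots_def)
    show "x + y \<in> ?P" if "id x \<bullet> id y < 0" "id x \<noteq> - id y"
      using root_sum[OF R, of x y] P[OF x] P[OF y] span_plus_add that by (auto simp: pos_roots_def)
    show "c = 1 \<or> c = -1" if "id x = c *\<^sub>R id y" for c
      using root_reduced[OF R, of x y c] P(1)[OF x] P(1)[OF y] that by simp
  next
    show "0 < f v" if "v \<in> span_plus \<Delta>" "v \<noteq> 0" for v
      using f(3,4)[OF that(1)] that(2) by fastforce
  qed
  \<comment> \<open>Opposite roots have opposite heights, so only equality survives; this
    trivialises degenerate triples in the finite case.\<close>
  have pos: "x = y" if "x \<in> ?P" "y \<in> ?P" "id x = id y \<or> id x = - id y" for x y
    using that ht_root_pos[OF that(1)] ht_root_pos[OF that(2)] linear_neg[OF f(1), of y] by auto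
  interpret extendable_root_cone ?P \<Delta> id f
  proof
    fix J \<beta> X Y assume F: "frontier_root J \<beta>" and part: "bipartition J X Y"
    have bP: "\<beta> \<in> ?P" "\<beta> \<notin> J" and JP: "J \<subseteq> ?P" using F by (auto simp: frontier_root_def ideal_def)
    have XY: "X \<union> Y = J" "X \<inter> Y = {}" using part by (auto simp: bipartition_def)
    have sums: "\<exists>\<alpha>1\<in>X. \<exists>\<alpha>2\<in>X. \<beta> = \<alpha>1 + \<alpha>2" if "forced X \<beta>" "X \<subseteq> J" for X
    proof -
      obtain \<alpha>1 \<alpha>2 where h: "\<alpha>1 \<in> X" "\<alpha>2 \<in> X" "triple \<beta> \<alpha>1 \<alpha>2"
        using \<open>forced X \<beta>\<close> unfolding forced_def by blast
      have "\<alpha>1 \<in> ?P" "\<alpha>1 \<noteq> \<beta>" using h(1) \<open>X \<subseteq> J\<close> JP bP by blast+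
      then have "\<not> (id \<alpha>1 = id \<beta> \<or> id \<alpha>1 = - id \<beta>)" using pos[OF _ bP(1)] by blast
      then have "\<beta> = \<alpha>1 + \<alpha>2" using h(3) unfolding triple_def deg_triple_def by blast
      then show ?thesis using h by blast
    qed
    show False if forc: "forced X \<beta>" "forced Y \<beta>"
    proof -
      obtain \<alpha>1 \<alpha>2 \<gamma>1 \<gamma>2 where h: "\<alpha>1 \<in> X" "\<alpha>2 \<in> X" "\<beta> = \<alpha>1 + \<alpha>2" "\<gamma>1 \<in> Y" "\<gamma>2 \<in> Y" "\<beta> = \<gamma>1 + \<gamma>2"
        using sums[OF forc(1)] sums[OF forc(2)] XY by blast
      \<comment> \<open>Equal projections are now equal roots, against the disjointness of the
        blocks.\<close>
      show False using sum_sum_same_projection[OF F part h] h(1,2,4,5) XY(2) by auto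
    qed
    show "forced Y \<beta>" if "\<alpha> \<in> X" "\<gamma> \<in> Y" "deg_triple \<gamma> \<beta> \<alpha>" for \<alpha> \<gamma>
    proof -
      have "\<gamma> \<in> ?P" "\<gamma> \<noteq> \<beta>" using that(2) bP JP XY by blast+
      then show ?thesis using pos[OF bP(1), of \<gamma>] that(3) unfolding deg_triple_def by blast
    qed
  qed
  show ?thesis by (rule extension_property) simp
qed

section \<open>Affine root systems\<close>

text \<open>Only \<open>(- \<theta>, 1)\<close> has a nonzero second coordinate, so its coefficient
  is t, and what remains is v + t \<theta>.\<close>

lemma span_plus_aff_base:
  assumes fin: "finite \<Delta>0"
  shows "(v, t) \<in> span_plus (aff_base \<Delta>0 \<theta>) \<longleftrightarrow> 0 \<le> t \<and> v + t *\<^sub>R \<theta> \<in> span_plus \<Delta>0"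
proof -
  let ?S = "(\<lambda>\<alpha>. (\<alpha>, 0::real)) ` \<Delta>0"
  have sum: "(\<Sum>p\<in>aff_base \<Delta>0 \<theta>. c p *\<^sub>R p)
      = ((\<Sum>\<alpha>\<in>\<Delta>0. c (\<alpha>, 0) *\<^sub>R \<alpha>) - c (- \<theta>, 1) *\<^sub>R \<theta>, c (- \<theta>, 1))" for c
  proof -
    have "(\<Sum>p\<in>aff_base \<Delta>0 \<theta>. c p *\<^sub>R p) = (\<Sum>p\<in>?S. c p *\<^sub>R p) + c (- \<theta>, 1) *\<^sub>R (- \<theta>, 1)"
      unfolding aff_base_def using fin by (subst sum.union_disjoint) auto
    also have "(\<Sum>p\<in>?S. c p *\<^sub>R p) = (\<Sum>\<alpha>\<in>\<Delta>0. c (\<alpha>, 0) *\<^sub>R (\<alpha>, 0))"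
      by (subst sum.reindex) (auto simp: inj_on_def)
    also have "\<dots> = (\<Sum>\<alpha>\<in>\<Delta>0. c (\<alpha>, 0) *\<^sub>R \<alpha>, 0)"
      by (simp add: sum_prod[symmetric] prod_eq_iff fst_sum snd_sum)
    finally show ?thesis by simp
  qed
  show ?thesis
  proof
    assume "(v, t) \<in> span_plus (aff_base \<Delta>0 \<theta>)"
    then obtain c where c: "\<forall>p\<in>aff_base \<Delta>0 \<theta>. 0 \<le> c p" "(v, t) = (\<Sum>p\<in>aff_base \<Delta>0 \<theta>. c p *\<^sub>R p)"
      unfolding span_plus_def by blast
    have "t = c (- \<theta>, 1)" "v + t *\<^sub>R \<theta> = (\<Sum>\<alpha>\<in>\<Delta>0. c (\<alpha>, 0) *\<^sub>R \<alpha>)"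
      using c(2) unfolding sum by auto
    then show "0 \<le> t \<and> v + t *\<^sub>R \<theta> \<in> span_plus \<Delta>0"
      using c(1) span_plus_sum[of \<Delta>0 "\<lambda>\<alpha>. c (\<alpha>, 0)"] by (auto simp: aff_base_def)
  next
    assume "0 \<le> t \<and> v + t *\<^sub>R \<theta> \<in> span_plus \<Delta>0"
    then obtain d where d: "0 \<le> t" "\<forall>v\<in>\<Delta>0. 0 \<le> d v" "v + t *\<^sub>R \<theta> = (\<Sum>v\<in>\<Delta>0. d v *\<^sub>R v)"
      unfolding span_plus_def by blast
    \<comment> \<open>The second coordinate tells the affine base vector from the finite
      ones.\<close>
    define c where "c = (\<lambda>p :: 'a \<times> real. if snd p = 1 then t else d (fst p))"
    have "\<forall>p\<in>aff_base \<Delta>0 \<theta>. 0 \<le> c p" using d by (auto simp: c_def aff_base_def)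
    moreover have "(v, t) = (\<Sum>p\<in>aff_base \<Delta>0 \<theta>. c p *\<^sub>R p)"
      unfolding sum by (simp add: c_def d(3)[symmetric])
    ultimately show "(v, t) \<in> span_plus (aff_base \<Delta>0 \<theta>)" unfolding span_plus_def by blast
  qed
qed

locale affine_root_system =
  fixes \<Phi> \<Delta> :: "'a::euclidean_space set" and \<theta> :: 'a and f :: "'a \<Rightarrow> real"
  assumes R: "finite_root_system \<Phi>" and base: "is_base \<Phi> \<Delta>" and highest: "highest_root \<Phi> \<Delta> \<theta>"
    and lin_f: "linear f" and f_int: "x \<in> \<Phi> \<Longrightarrow> f x \<in> \<int>"
    and f_nonneg: "v \<in> span_plus \<Delta> \<Longrightarrow> 0 \<le> f v"
    and f_zero: "v \<in> span_plus \<Delta> \<Longrightarrow> f v = 0 \<Longrightarrow> v = 0"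
begin

abbreviation "aD \<equiv> aff_base \<Delta> \<theta>"
abbreviation "aP \<equiv> pos_roots (aff_roots \<Phi>) aD"

text \<open>The vector x + k\<delta>. Since \<open>x\<close> may be any vector,
  \<open>rt 0 n\<close> denotes the imaginary n\<delta>.\<close>

definition rt :: "'a \<Rightarrow> int \<Rightarrow> 'a \<times> real" where "rt x k = (x, of_int k)"

text \<open>The least \<open>k\<close> such that \<open>x + k\<delta>\<close> is a positive root.\<close>
definition eps :: "'a \<Rightarrow> int" where "eps x = (if x \<in> span_plus \<Delta> then 0 else 1)"

lemma rt_add: "rt x k + rt y l = rt (x + y) (k + l)" by (simp add: rt_def)
lemma rt_diff: "rt x k - rt y l = rt (x - y) (k - l)" by (simp add: rt_def)
lemma rt_inj [simp]: "rt x k = rt y l \<longleftrightarrow> x = y \<and> k = l" by (simp add: rt_def)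
lemma fst_rt [simp]: "fst (rt x k) = x" by (simp add: rt_def)

lemma root_nz: "x \<in> \<Phi> \<Longrightarrow> x \<noteq> 0" using R by (auto simp: finite_root_system_def)

lemma finite_base: "finite \<Delta>"
  using base unfolding is_base_def by (auto intro: independent_imp_finite)

lemmas cone_iff = span_plus_aff_base[OF finite_base, of _ _ \<theta>]

lemma neg_root: "x \<in> \<Phi> \<Longrightarrow> - x \<in> \<Phi>" by (rule root_neg[OF R])

lemma not_both_pos: "x \<in> \<Phi> \<Longrightarrow> x \<in> span_plus \<Delta> \<Longrightarrow> - x \<notin> span_plus \<Delta>"
  using f_nonneg[of x] f_nonneg[of "- x"] f_zero[of x] root_nz linear_neg[OF lin_f, of x] by auto

lemma eps_neg: "x \<in> \<Phi> \<Longrightarrow> eps (- x) = 1 - eps x"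
  using not_both_pos[of x] root_pos_or_neg[OF base, of x] by (auto simp: eps_def)

lemma eps_add: "eps (x + y) \<le> eps x + eps y"
  using span_plus_add[of x \<Delta> y] by (auto simp: eps_def)

lemma eps_range: "0 \<le> eps x" "eps x \<le> 1" by (auto simp: eps_def)

lemma theta_pos: "\<theta> \<in> span_plus \<Delta>" using highest by (simp add: highest_root_def pos_roots_def)

lemma theta_add: "x \<in> \<Phi> \<Longrightarrow> x + \<theta> \<in> span_plus \<Delta>"
proof -
  assume x: "x \<in> \<Phi>"
  show ?thesis
  proof (cases "x \<in> span_plus \<Delta>")
    case True
    then show ?thesis using span_plus_add theta_pos by blast
  next
    case False
    then have "- x \<in> pos_roots \<Phi> \<Delta>" using x neg_root root_pos_or_neg[OF base x] by (auto simp: pos_roots_def)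
    then have "\<theta> - (- x) \<in> span_plus \<Delta>" using highest unfolding highest_root_def root_le_def by blast
    then show ?thesis by (simp add: add.commute)
  qed
qed

text \<open>For k \<ge> 1 the vector x + k \<theta> is in the finite cone, as - x lies below
  \<theta>; level 0 asks for x itself.\<close>

lemma rt_cone_iff: "x \<in> \<Phi> \<Longrightarrow> rt x k \<in> span_plus aD \<longleftrightarrow> eps x \<le> k"
proof -
  assume x: "x \<in> \<Phi>"
  consider "k < 0" | "k = 0" | "k \<ge> 1" by linarith
  then show ?thesis
  proof cases
    case 3
    have "(x + \<theta>) + of_int (k - 1) *\<^sub>R \<theta> \<in> span_plus \<Delta>"
      using 3 by (intro span_plus_add theta_add x span_plus_scale theta_pos) auto
    then have "x + of_int k *\<^sub>R \<theta> \<in> span_plus \<Delta>" by (simp add: algebra_simps)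
    then show ?thesis using 3 eps_range(2)[of x] by (simp add: rt_def cone_iff)
  qed (auto simp: rt_def cone_iff eps_def)
qed

lemma rt_P_iff: "rt x k \<in> aP \<longleftrightarrow> x \<in> \<Phi> \<and> eps x \<le> k"
proof -
  have "rt x k \<in> aff_roots \<Phi> \<longleftrightarrow> x \<in> \<Phi>" by (auto simp: aff_roots_def rt_def)
  then show ?thesis using rt_cone_iff[of x k] by (auto simp: pos_roots_def)
qed

lemma P_rt: "p \<in> aP \<Longrightarrow> \<exists>x k. p = rt x k \<and> x \<in> \<Phi> \<and> eps x \<le> k"
proof -
  assume p: "p \<in> aP"
  then obtain x k where "p = rt x k" by (auto simp: pos_roots_def aff_roots_def rt_def)
  then show ?thesis using p rt_P_iff by blast
qed

lemma delta_cone: "0 \<le> n \<Longrightarrow> rt 0 n \<in> span_plus aD"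
  using span_plus_scale[OF _ theta_pos] by (simp add: rt_def cone_iff)

lemma rt_sum_cone: "x \<in> \<Phi> \<Longrightarrow> y \<in> \<Phi> \<Longrightarrow> eps x + eps y \<le> n \<Longrightarrow> rt (x + y) n \<in> span_plus aD"
  using span_plus_add[of "rt x (eps x)" aD "rt y (n - eps x)"] by (simp add: rt_add rt_cone_iff)

text \<open>\<delta> gets the value 1 + f \<theta>, so that the affine base vector \<delta> -
  \<theta> gets 1.\<close>

definition ht :: "'a \<times> real \<Rightarrow> real" where "ht p = f (fst p) + snd p * (1 + f \<theta>)"

lemma affine_root_cone: "root_cone aP aD fst ht"
proof (rule root_cone.intro)
  show "linear (fst :: 'a \<times> real \<Rightarrow> 'a)" by (rule linear_fst)
  show "linear ht" unfolding ht_def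
    by (rule linearI) (simp_all add: linear_add[OF lin_f] linear_scale[OF lin_f] algebra_simps)
  show "aP \<subseteq> span_plus aD" by (auto simp: pos_roots_def)
  have ht: "0 \<le> ht v \<and> (ht v = 0 \<longrightarrow> v = 0)" if "v \<in> span_plus aD" for v
  proof -
    obtain u t where v: "v = (u, t)" by (cases v)
    have t: "0 \<le> t" "u + t *\<^sub>R \<theta> \<in> span_plus \<Delta>" using that by (auto simp: v cone_iff)
    have "ht v = f (u + t *\<^sub>R \<theta>) + t"
      by (simp add: ht_def v linear_add[OF lin_f] linear_scale[OF lin_f] algebra_simps)
    moreover have "v = 0" if "f (u + t *\<^sub>R \<theta>) = 0" "t = 0"
      using f_zero[OF t(2) that(1)] that(2) by (simp add: v zero_prod_def)
    ultimately show ?thesis using t(1) f_nonneg[OF t(2)] by linarith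
  qed
  then show "0 < ht v" if "v \<in> span_plus aD" "v \<noteq> 0" for v using that by fastforce
  have th: "\<theta> \<in> \<Phi>" using highest by (simp add: highest_root_def pos_roots_def)
  fix p q assume p: "p \<in> aP"
  then obtain x k where x: "p = rt x k" "x \<in> \<Phi>" "eps x \<le> k" using P_rt by blast
  have "ht p \<in> \<int>" unfolding ht_def x(1) using f_int[OF x(2)] f_int[OF th] by (simp add: rt_def)
  moreover have "0 \<le> ht p" using ht p by (simp add: pos_roots_def)
  ultimately show "ht p \<in> \<nat>" by (rule Ints_nonneg_Nats)
  show "fst p \<noteq> 0" using x root_nz by simp
  assume q: "q \<in> aP"
  then obtain y l where y: "q = rt y l" "y \<in> \<Phi>" "eps y \<le> l" using P_rt by blast
  show "2 * (fst p \<bullet> fst q) / (fst q \<bullet> fst q) \<in> \<int>"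
    using x y R by (simp add: finite_root_system_def)
  show "p - q \<in> aP \<or> q - p \<in> aP" if "0 < fst p \<bullet> fst q" "fst p \<noteq> fst q"
  proof -
    \<comment> \<open>\<open>eps\<close> adds up to 1 on opposite roots, so for each integer n one
      of (x - y) + n\<delta> and its negative is positive.\<close>
    have "x - y \<in> \<Phi>" using root_diff[OF R x(2) y(2)] that x y by simp
    then have "eps (y - x) = 1 - eps (x - y)" "y - x \<in> \<Phi>" using eps_neg[of "x - y"] neg_root[of "x - y"] by auto
    then show ?thesis using \<open>x - y \<in> \<Phi>\<close> by (auto simp: x(1) y(1) rt_diff rt_P_iff)
  qed
  show "p + q \<in> aP" if "fst p \<bullet> fst q < 0" "fst p \<noteq> - fst q"
    using root_sum[OF R x(2) y(2)] that x y eps_add[of x y] by (simp add: rt_add rt_P_iff)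
  show "c = 1 \<or> c = -1" if "fst p = c *\<^sub>R fst q" for c
    using root_reduced[OF R x(2) y(2)] that x y by simp
qed

sublocale root_cone aP aD fst ht by (rule affine_root_cone)

section \<open>Strings of affine roots\<close>


lemma rt_below:
  assumes "ideal J" "rt x m \<in> J" "y \<in> \<Phi>" "eps y \<le> l" "rt (x - y) (m - l) \<in> span_plus aD"
  shows "rt y l \<in> J"
  using assms unfolding ideal_def root_le_def by (metis rt_P_iff rt_diff)

lemma rt_below_frontier:
  assumes "frontier_root J (rt x m)" "y \<in> \<Phi>" "eps y \<le> l" "rt (x - y) (m - l) \<in> span_plus aD"
    "y \<noteq> x \<or> l \<noteq> m"
  shows "rt y l \<in> J"
  using assms unfolding frontier_root_def root_le_def by (metis rt_P_iff rt_diff rt_inj)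

lemma ideal_P: "ideal J \<Longrightarrow> rt x k \<in> J \<Longrightarrow> x \<in> \<Phi> \<and> eps x \<le> k"
  unfolding ideal_def using rt_P_iff by blast

lemma rt_lower: "ideal J \<Longrightarrow> rt x m \<in> J \<Longrightarrow> eps x \<le> l \<Longrightarrow> l \<le> m \<Longrightarrow> rt x l \<in> J"
  by (rule rt_below) (auto simp: delta_cone dest: ideal_P)

text \<open>The difference is 2x + (m - 1 + eps x)\<delta>, which is twice the lowest root of the
  string of \<open>x\<close> plus a nonnegative multiple of \<delta> once m exceeds eps x.\<close>

lemma rt_lowest_neg:
  assumes J: "ideal J" and x: "rt x m \<in> J" "eps x < m"
  shows "rt (- x) (eps (- x)) \<in> J"
proof (rule rt_below[OF J x(1)])
  have xR: "x \<in> \<Phi>" using ideal_P[OF J x(1)] by simp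
  then show "- x \<in> \<Phi>" by (rule neg_root)
  show "rt (x - - x) (m - eps (- x)) \<in> span_plus aD"
    using rt_sum_cone[OF xR xR, of "m - eps (- x)"] x(2) eps_neg[OF xR] by simp
qed simp

text \<open>The two roots add up to (i + j)\<delta> with i + j \<ge> 1, and a positive multiple of
  this lifts x + i\<delta> to x + k\<delta>.\<close>

lemma deg_triple_rt:
  assumes x: "x \<in> \<Phi>" "eps x \<le> i" "eps (- x) \<le> j" "i < k"
  shows "deg_triple (rt x k) (rt x i) (rt (- x) j)"
proof -
  have ij: "i + j \<ge> 1" using x(2,3) eps_neg[OF x(1)] by simp
  define b where "b = of_int (k - i) / (of_int (i + j) :: real)"
  have b: "b > 0" using ij x(4) by (simp add: b_def)
  have "b * of_int (i + j) = of_int (k - i)" using ij by (simp add: b_def flip: of_int_add)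
  then have "rt x k = (1 + b) *\<^sub>R rt x i + b *\<^sub>R rt (- x) j"
    by (simp add: rt_def algebra_simps)
  moreover have "1 + b > 0" using b by simp
  ultimately have "\<exists>a>0. \<exists>b>0. rt x k = a *\<^sub>R rt x i + b *\<^sub>R rt (- x) j" using b by blast
  then show ?thesis by (simp add: deg_triple_def)
qed

lemma partition_mem:
  assumes "frontier_root J \<beta>" "bipartition J X Y"
  shows "X \<union> Y = J" "X \<inter> Y = {}" "ideal J"
    "\<And>x k. rt x k \<in> X \<Longrightarrow> x \<in> \<Phi> \<and> eps x \<le> k"
  using assms ideal_P[of J] by (auto simp: bipartition_def frontier_root_def)

text \<open>A root of the opposite string lets \<open>X\<close> climb from level i to every higher
  level within \<open>J\<close>. The opposite root is a variable \<open>y\<close>, so that the lemma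
  also applies with - x in the role of x.\<close>

lemma partition_string:
  assumes J: "ideal J" and part: "bipartition J X Y"
    and x: "rt x i \<in> X" "rt y j \<in> X" "y = - x" "rt x k \<in> J" "i < k"
  shows "rt x k \<in> X"
proof -
  have "X \<subseteq> J" using part by (auto simp: bipartition_def)
  then have "x \<in> \<Phi> \<and> eps x \<le> i" "eps (- x) \<le> j" using x ideal_P[OF J] by auto
  then have "triple (rt x k) (rt x i) (rt y j)" using deg_triple_rt x by (simp add: triple_def)
  then show ?thesis using part x unfolding bipartition_def triple_closed_def by blast
qed

section \<open>Strings on which the blocks cross\<close>

text \<open>The string \<open>x + k\<delta>\<close> enters \<open>X\<close> at some point, so \<open>X\<close> contains the roots \<open>- x + k\<delta>\<close> of \<open>J\<close>; dually
  \<open>Y\<close> contains the roots \<open>- y + k\<delta>\<close>. Adding the lowest of these to \<open>\<beta> - \<delta>\<close> brings the string of \<open>y\<close> back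
  into \<open>X\<close>, or that of \<open>x\<close> back into \<open>Y\<close>.\<close>
lemma no_crossing_aux:
  assumes F: "frontier_root J (rt (x + y) (i + j + m))" and part: "bipartition J X Y" and m: "m \<ge> 1"
    and x: "rt x i \<in> Y" "rt x (i + m) \<in> X" and y: "rt y j \<in> X" "rt y (j + m) \<in> Y"
    and xy: "rt (x + y) (i + j + m - 1) \<in> X"
  shows False
proof -
  note pt = partition_swap[OF part]
  note XY = partition_mem[OF F part] and YX = partition_mem(4)[OF F pt]
  have xR: "x \<in> \<Phi>" "eps x \<le> i" and yR: "y \<in> \<Phi>" "eps y \<le> j" using YX[OF x(1)] XY(4)[OF y(1)] by auto
  have xJ: "rt x (i + m) \<in> J" and yJ: "rt y (j + m) \<in> J" using x y XY by auto
  have nxJ: "rt (- x) (eps (- x)) \<in> J" and nyJ: "rt (- y) (eps (- y)) \<in> J"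
    using rt_lowest_neg[OF XY(3)] xJ yJ xR yR m by auto
  have nxX: "rt (- x) (eps (- x)) \<in> X"
  proof (rule ccontr)
    assume "\<not> ?thesis"
    then have "rt (- x) (eps (- x)) \<in> Y" using nxJ XY by auto
    then have "rt x (i + m) \<in> Y" using partition_string[OF XY(3) pt x(1) _ refl xJ] m by simp
    then show False using x XY by auto
  qed
  \<comment> \<open>The level at which (\<beta> - \<delta>) plus the lowest root of the string of -
    x meets the string of \<open>y\<close>. It is at least j + m, so \<open>Y\<close> reaches it by
    climbing, while the sum puts it into \<open>X\<close>.\<close>
  define l where "l = i + j + m - 1 + eps (- x)"
  have l: "l = j + m + (i - eps x)" using eps_neg[OF xR(1)] by (simp add: l_def)
  have lJ: "rt y l \<in> J"
  proof (rule rt_below_frontier[OF F yR(1)])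
    show "eps y \<le> l" using l xR yR m by simp
    have "i + j + m - l = eps x" using l by simp
    then show "rt (x + y - y) (i + j + m - l) \<in> span_plus aD" using xR by (simp add: rt_cone_iff)
    show "y \<noteq> x + y \<or> l \<noteq> i + j + m" using root_nz[OF xR(1)] by simp
  qed
  have "rt (x + y) (i + j + m - 1) + rt (- x) (eps (- x)) = rt y l" by (simp add: rt_add l_def)
  then have lX: "rt y l \<in> X" using partition_sum[OF part xy nxX] lJ by simp
  have nyY: "rt (- y) (eps (- y)) \<in> Y"
  proof (rule ccontr)
    assume "\<not> ?thesis"
    then have "rt (- y) (eps (- y)) \<in> X" using nyJ XY by auto
    then have "rt y (j + m) \<in> X" using partition_string[OF XY(3) part y(1) _ refl yJ] m by simp
    then show False using y XY by auto
  qed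
  have "rt y l \<in> Y"
  proof (cases "l = j + m")
    case True
    then show ?thesis using y by simp
  next
    case False
    then show ?thesis using partition_string[OF XY(3) pt y(2) nyY refl lJ] l xR by simp
  qed
  then show False using lX XY by auto
qed

lemma rt_minus_delta:
  assumes F: "frontier_root J (rt x k)" and k: "eps x \<le> k - 1"
  shows "rt x (k - 1) \<in> J"
proof (rule rt_below_frontier[OF F])
  show "x \<in> \<Phi>" using F by (simp add: frontier_root_def rt_P_iff)
qed (use k in \<open>auto simp: delta_cone\<close>)

text \<open>\<beta> - \<delta> is still positive, so it lies in one of the blocks; the hypotheses
  are symmetric under exchanging \<open>x\<close> with \<open>y\<close> and \<open>X\<close> with
  \<open>Y\<close>.\<close>

lemma no_crossing:
  assumes F: "frontier_root J (rt (x + y) (i + j + m))" and part: "bipartition J X Y" and m: "m \<ge> 1"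
    and x: "rt x i \<in> Y" "rt x (i + m) \<in> X" and y: "rt y j \<in> X" "rt y (j + m) \<in> Y"
  shows False
proof -
  note pt = partition_swap[OF part]
  have "eps x \<le> i" "eps y \<le> j"
    using partition_mem(4)[OF F part y(1)] partition_mem(4)[OF F pt x(1)] by auto
  then have "eps (x + y) \<le> i + j + m - 1" using eps_add[of x y] m by linarith
  then have "rt (x + y) (i + j + m - 1) \<in> J" by (rule rt_minus_delta[OF F])
  then consider "rt (x + y) (i + j + m - 1) \<in> X" | "rt (x + y) (i + j + m - 1) \<in> Y"
    using partition_mem(1)[OF F part] by auto
  then show False
  proof cases
    case 1
    then show False by (rule no_crossing_aux[OF F part m x y])
  next
    case 2
    then show False using no_crossing_aux[of J y x j i m, OF _ pt m y x] F
      by (simp add: add.commute add.left_commute)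
  qed
qed

text \<open>Both decompositions use the same two strings, with levels shifted by opposite amounts.
  On one string the root of \<open>X\<close> is the higher one and on the other the root of
  \<open>Y\<close>, which is a crossing.\<close>

lemma sum_sum_contradiction_aux:
  assumes F: "frontier_root J \<beta>" and part: "bipartition J X Y"
    and h: "\<alpha>1 \<in> X" "\<alpha>2 \<in> X" "\<beta> = \<alpha>1 + \<alpha>2" "\<gamma>1 \<in> Y" "\<gamma>2 \<in> Y" "\<beta> = \<gamma>1 + \<gamma>2"
    and eq: "fst \<alpha>1 = fst \<gamma>1"
  shows False
proof -
  note pt = partition_swap[OF part]
  note XY = partition_mem[OF F part]
  have JP: "J \<subseteq> aP" using XY(3) by (simp add: ideal_def)
  then have "\<alpha>1 \<in> aP" "\<alpha>2 \<in> aP" "\<gamma>1 \<in> aP" "\<gamma>2 \<in> aP" using h XY(1) by blast+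
  then obtain x a y b z c w d where rts: "\<alpha>1 = rt x a" "\<alpha>2 = rt y b" "\<gamma>1 = rt z c" "\<gamma>2 = rt w d"
    using P_rt[of \<alpha>1] P_rt[of \<alpha>2] P_rt[of \<gamma>1] P_rt[of \<gamma>2] by blast
  have z: "z = x" using eq rts by simp
  have beta: "\<beta> = rt (x + y) (a + b)" using h rts by (simp add: rt_add)
  have w: "w = y" "a + b = c + d" using h(6) beta rts z by (auto simp: rt_add)
  have e: "d + (c - a) = b" "b + (a - c) = d" using w by auto
  have ne: "a \<noteq> c" using h rts z XY by auto
  have r: "rt x a \<in> X" "rt y b \<in> X" "rt x c \<in> Y" "rt y d \<in> Y" using h(1,2,4,5) rts z w(1) by auto
  have r': "rt x (c + (a - c)) \<in> X" "rt y (d + (c - a)) \<in> X" "rt x (a + (c - a)) \<in> Y" "rt y (b + (a - c)) \<in> Y"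
    unfolding e using r by simp_all
  show False
  proof (cases "c < a")
    case True
    have "frontier_root J (rt (x + y) (c + b + (a - c)))" using F beta by (simp add: add.commute)
    then show False
      by (rule no_crossing[OF _ part _ r(3) r'(1) r(2) r'(4)]) (use True in simp)
  next
    case False
    have "frontier_root J (rt (x + y) (a + d + (c - a)))" using F beta w by (simp add: add.commute)
    then show False
      by (rule no_crossing[OF _ pt _ r(1) r'(3) r(4) r'(2)]) (use False ne in simp)
  qed
qed

lemma sum_sum_contradiction:
  assumes F: "frontier_root J \<beta>" and part: "bipartition J X Y"
    and h: "\<alpha>1 \<in> X" "\<alpha>2 \<in> X" "\<beta> = \<alpha>1 + \<alpha>2" "\<gamma>1 \<in> Y" "\<gamma>2 \<in> Y" "\<beta> = \<gamma>1 + \<gamma>2"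
  shows False
proof -
  have h': "\<beta> = \<alpha>2 + \<alpha>1" "\<beta> = \<gamma>2 + \<gamma>1" using h by (auto simp: add.commute)
  note aux = sum_sum_contradiction_aux[OF F part]
  show False using sum_sum_same_projection[OF F part h] aux[OF h] aux[OF h(1-3) h(5,4) h'(2)]
      aux[OF h(2,1) h'(1) h(4-6)] aux[OF h(2,1) h'(1) h(5,4) h'(2)] by blast
qed

section \<open>Roots forced within their own string\<close>

text \<open>Such a pair forces \<open>rt x k\<close> by \<open>deg_triple_rt\<close>;
  \<open>forced_cases\<close> shows that for a frontier root this is the only alternative to a
  sum.\<close>

definition string_forced :: "('a \<times> real) set \<Rightarrow> 'a \<Rightarrow> int \<Rightarrow> bool" where
  "string_forced X x k \<longleftrightarrow> (\<exists>i j. i < k \<and> rt x i \<in> X \<and> rt (- x) j \<in> X)"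

text \<open>All three roots lie in the plane of x and \<delta>. The x-coordinate excludes two minus
  signs and ties a to b; the \<delta>-coordinate relates the levels.\<close>

lemma deg_triple_coords:
  assumes P: "rt y l \<in> aP" "rt z m \<in> aP" "rt x k \<in> aP" and d: "deg_triple (rt x k) (rt y l) (rt z m)"
  obtains a b where "a > 0" "b > 0" "of_int k = a * of_int l + b * (of_int m :: real)"
    "y = x \<and> z = x \<and> a + b = 1 \<or> y = x \<and> z = - x \<and> a = 1 + b \<or> y = - x \<and> z = x \<and> b = 1 + a"
proof -
  obtain a b where ab: "a > 0" "b > 0" "rt x k = a *\<^sub>R rt y l + b *\<^sub>R rt z m"
    using d unfolding deg_triple_def by blast
  have y: "y = x \<or> y = - x" using d by (simp add: deg_triple_def)
  have z: "z = x \<or> z = - x" using deg_triple_swap[OF P d] by (simp add: deg_triple_def)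
  have x0: "x \<noteq> 0" using P(3) rt_P_iff root_nz by blast
  have k: "of_int k = a * of_int l + b * (of_int m :: real)" and x: "a *\<^sub>R y + b *\<^sub>R z = x"
    using ab(3) by (auto simp: rt_def)
  have lin: "r = 1" if "r *\<^sub>R x = x" for r
    using that x0 by (metis scaleR_cancel_right scaleR_one)
  consider "y = x" "z = x" | "y = x" "z = - x" | "y = - x" "z = x" | "y = - x" "z = - x" using y z by blast
  then show thesis
  proof cases
    case 1
    then have "a + b = 1" using x by (intro lin) (simp add: scaleR_add_left)
    then show thesis using that ab k 1 by blast
  next
    case 2
    then have "a - b = 1" using x by (intro lin) (simp add: scaleR_diff_left)
    then show thesis using that[OF ab(1,2) k] 2 by simp
  next
    case 3
    then have "b - a = 1" using x by (intro lin) (simp add: scaleR_diff_left)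
    then show thesis using that[OF ab(1,2) k] 3 by simp
  next
    case 4
    then have "- a - b = 1" using x by (intro lin) (simp add: scaleR_diff_left)
    then show thesis using ab by simp
  qed
qed


lemma frontier_string_less:
  assumes F: "frontier_root J (rt x k)" and J: "rt x l \<in> J"
  shows "l < k"
proof (rule ccontr)
  assume "\<not> l < k"
  then have "root_le aD (rt x k) (rt x l)" by (simp add: root_le_def rt_diff delta_cone)
  then show False using frontier_root_not_le[OF F J] by simp
qed

lemma convex_combination_le:
  fixes a b :: real and k l m :: int
  assumes "a > 0" "b > 0" "a + b = 1" "of_int k = a * of_int l + b * (of_int m :: real)" "l < k"
  shows "k < m"
proof (rule ccontr)
  assume "\<not> k < m"
  then have "a * of_int l < a * of_int k" "b * of_int m \<le> b * (of_int k :: real)" using assms by auto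
  moreover have "a * of_int k + b * of_int k = (of_int k :: real)"
    using assms(3) by (metis distrib_right mult_1)
  ultimately show False using assms(4) by linarith
qed

lemma reflected_combination_less:
  fixes a b :: real and k l m :: int
  assumes "b > 0" "a = 1 + b" "of_int k = a * of_int l + b * (of_int m :: real)" "l + m \<ge> 1"
  shows "l < k"
proof -
  have "of_int k = of_int l + b * of_int (l + m)" using assms(2,3) by (simp add: algebra_simps)
  moreover have "b * of_int (l + m) > 0" using assms(1,4) by (intro mult_pos_pos) auto
  ultimately show ?thesis by linarith
qed

lemma neg_sum_pos: "x \<in> \<Phi> \<Longrightarrow> eps x \<le> i \<Longrightarrow> eps (- x) \<le> j \<Longrightarrow> i + j \<ge> 1"
  using eps_neg[of x] by simp

text \<open>The frontier root lies above all roots of \<open>J\<close> in its string, so it is no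
  convex combination of two of them. The mixed sign patterns are exactly
  \<open>string_forced\<close>.\<close>

lemma forced_cases:
  assumes F: "frontier_root J (rt x k)" and part: "bipartition J X Y" and forced: "forced X (rt x k)"
  shows "(\<exists>\<alpha>1\<in>X. \<exists>\<alpha>2\<in>X. rt x k = \<alpha>1 + \<alpha>2) \<or> string_forced X x k"
proof -
  note XY = partition_mem[OF F part]
  have XP: "X \<subseteq> aP" using XY by (auto simp: ideal_def)
  obtain \<alpha>1 \<alpha>2 where a: "\<alpha>1 \<in> X" "\<alpha>2 \<in> X" "triple (rt x k) \<alpha>1 \<alpha>2"
    using forced unfolding forced_def by blast
  show ?thesis
  proof (cases "rt x k = \<alpha>1 + \<alpha>2")
    case False
    then have d: "deg_triple (rt x k) \<alpha>1 \<alpha>2" using a by (simp add: triple_def)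
    obtain y l z m where rts: "\<alpha>1 = rt y l" "\<alpha>2 = rt z m"
      using P_rt[of \<alpha>1] P_rt[of \<alpha>2] a XP by blast
    have P: "rt y l \<in> aP" "rt z m \<in> aP" "rt x k \<in> aP"
      using a XP rts F by (auto simp: frontier_root_def)
    have in_X: "rt y l \<in> X" "rt z m \<in> X" and J: "rt y l \<in> J" "rt z m \<in> J" using a rts XY by auto
    have x: "x \<in> \<Phi>" and pos: "eps y \<le> l" "eps z \<le> m" using P rt_P_iff by blast+
    obtain a b where ab: "a > 0" "b > 0" "of_int k = a * of_int l + b * (of_int m :: real)"
      and c: "y = x \<and> z = x \<and> a + b = 1 \<or> y = x \<and> z = - x \<and> a = 1 + b \<or> y = - x \<and> z = x \<and> b = 1 + a"
      using deg_triple_coords[OF P d[unfolded rts]] by blast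
    from c have "string_forced X x k"
    proof (elim disjE conjE)
      assume h: "y = x" "z = x" "a + b = 1"
      then have "l < k" "m < k" using frontier_string_less[OF F] J by auto
      then show ?thesis using convex_combination_le[OF ab(1,2) h(3) ab(3)] by simp
    next
      assume h: "y = x" "z = - x" "a = 1 + b"
      have "l < k" using reflected_combination_less[OF ab(2) h(3) ab(3)] neg_sum_pos[OF x] pos h by simp
      then show ?thesis unfolding string_forced_def using in_X h by blast
    next
      assume h: "y = - x" "z = x" "b = 1 + a"
      have "m < k"
        using reflected_combination_less[OF ab(1) h(3), of k m l] ab(3) neg_sum_pos[OF x] pos h by simp
      then show ?thesis unfolding string_forced_def using in_X h by blast
    qed
    then show ?thesis by blast
  qed (use a in blast)
qed

lemma string_forced_forced:
  assumes "frontier_root J \<beta>" "bipartition J X Y" "rt x i \<in> X" "rt (- x) j \<in> X" "i < k"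
  shows "forced X (rt x k)"
  using deg_triple_rt[of x i j k] partition_mem(4)[OF assms(1,2,3)] partition_mem(4)[OF assms(1,2,4)] assms(3-5)
  unfolding forced_def triple_def by blast

text \<open>The block that starts lower in the string climbs to the starting root of the other
  one.\<close>

lemma string_string_contradiction:
  assumes F: "frontier_root J (rt x k)" and part: "bipartition J X Y"
    and h: "string_forced X x k" "string_forced Y x k"
  shows False
proof -
  obtain i j where X: "i < k" "rt x i \<in> X" "rt (- x) j \<in> X" using h unfolding string_forced_def by blast
  obtain i' j' where Y: "i' < k" "rt x i' \<in> Y" "rt (- x) j' \<in> Y" using h unfolding string_forced_def by blast
  note XY = partition_mem[OF F part]
  have J: "rt x i \<in> J" "rt x i' \<in> J" using X Y XY by auto
  consider "i < i'" | "i' < i" | "i = i'" by linarith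
  then show False
  proof cases
    case 1
    then show False using partition_string[OF XY(3) part X(2,3) refl J(2)] Y XY by auto
  next
    case 2
    then show False using partition_string[OF XY(3) partition_swap[OF part] Y(2,3) refl J(1)] X XY by auto
  qed (use X Y XY in auto)
qed

text \<open>Used when \<open>Y\<close> contains both summands of \<beta> but \<open>X\<close>
  contains \<beta> - \<delta>: a root of \<open>X\<close> in the string of - x could then be
  combined with \<beta> - \<delta>, or with a root below x + p\<delta>, to contradict the summands
  being in \<open>Y\<close>.\<close>

lemma opposite_string_disjoint:
  assumes F: "frontier_root J (rt (x + y) (p + q))" and part: "bipartition J X Y"
    and xy: "rt (x + y) (p + q - 1) \<in> X" and x: "rt x p \<in> Y" and y: "rt y q \<in> Y"
  shows "rt (- x) (eps (- x)) \<in> J" "rt (- x) s \<notin> X"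
proof -
  note pt = partition_swap[OF part]
  note XY = partition_mem[OF F part] and YX = partition_mem(4)[OF F pt]
  have xR: "x \<in> \<Phi>" "eps x \<le> p" and xyR: "x + y \<in> \<Phi>" "eps (x + y) \<le> p + q - 1" and yR: "y \<in> \<Phi>"
    using YX[OF x] YX[OF y] XY(4)[OF xy] by auto
  have xJ: "rt x p \<in> J" and yJ: "rt y q \<in> J" using x y XY by auto
  note nx = neg_root[OF xR(1)] and e = eps_neg[OF xR(1)]
  show nJ: "rt (- x) (eps (- x)) \<in> J"
  proof (rule rt_below_frontier[OF F nx order_refl])
    show "rt (x + y - - x) (p + q - eps (- x)) \<in> span_plus aD"
      using rt_sum_cone[OF xyR(1) xR(1), of "p + q - eps (- x)"] xyR(2) e by simp
    have "- x \<noteq> x + y"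
    proof
      assume "- x = x + y"
      then have "y = - x - x" by (simp add: algebra_simps)
      then have "y = (- 2) *\<^sub>R x" by (simp add: scaleR_2)
      then show False using root_reduced[OF R yR xR(1)] by fastforce
    qed
    then show "- x \<noteq> x + y \<or> eps (- x) \<noteq> p + q" by simp
  qed
  show "rt (- x) s \<notin> X"
  proof
    assume s: "rt (- x) s \<in> X"
    then have sJ: "rt (- x) s \<in> J" "eps (- x) \<le> s" using XY by auto
    show False
    proof (cases "p = eps x")
      case True
      \<comment> \<open>At the bottom of the string of \<open>x\<close>, adding the lowest opposite
        root to \<beta> - \<delta> gives y + q\<delta>. So that opposite root is in
        \<open>Y\<close>, and with x + p\<delta> it draws - x + s\<delta> into
        \<open>Y\<close>.\<close>
      have sum: "rt (x + y) (p + q - 1) + rt (- x) (eps (- x)) = rt y q" using True e by (simp add: rt_add)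
      have "rt (- x) (eps (- x)) \<notin> X" using partition_sum[OF part xy, of "rt (- x) (eps (- x))"] sum yJ y XY(2) by auto
      then have nY: "rt (- x) (eps (- x)) \<in> Y" and "s \<noteq> eps (- x)" using nJ XY s by auto
      then have "rt (- x) s \<in> Y" using partition_string[OF XY(3) pt nY x _ sJ(1)] sJ by simp
      then show False using s XY by auto
    next
      case False
      \<comment> \<open>x + (p - 1)\<delta> and y + q\<delta> add up to \<beta> - \<delta>, so the
        former is in \<open>X\<close>; with - x + s\<delta> it would draw x + p\<delta> into
        \<open>X\<close>.\<close>
      have p1J: "rt x (p - 1) \<in> J" using rt_lower[OF XY(3) xJ, of "p - 1"] False xR by simp
      have sum: "rt x (p - 1) + rt y q = rt (x + y) (p + q - 1)" by (simp add: rt_add algebra_simps)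
      have "rt x (p - 1) \<notin> Y"
        using partition_sum[OF pt _ y, of "rt x (p - 1)"] sum xy XY by auto
      then have "rt x (p - 1) \<in> X" using p1J XY by auto
      then have "rt x p \<in> X" using partition_string[OF XY(3) part _ s refl xJ] by simp
      then show False using x XY by auto
    qed
  qed
qed

text \<open>For this \<open>j\<close>, adding the lowest root of the string of \<open>x\<close> to
  the given root of \<open>X\<close> yields the lowest root of the string of - y, which is not in
  \<open>X\<close>.\<close>

lemma lowest_in_complement:
  assumes J: "ideal J" and part: "bipartition J X Y"
    and xR: "x \<in> \<Phi>" and yR: "y \<in> \<Phi>" and n: "rt (- (x + y)) j \<in> X" and j: "j = 1 - eps x - eps y"
    and ny: "rt (- y) (eps (- y)) \<in> J" "rt (- y) (eps (- y)) \<notin> X"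
  shows "rt x (eps x) \<in> Y"
proof -
  have sum: "rt (- (x + y)) j + rt x (eps x) = rt (- y) (eps (- y))"
    using j eps_neg[OF yR] by (simp add: rt_add)
  have nP: "rt (- (x + y)) j \<in> aP" using n part J by (auto simp: bipartition_def ideal_def)
  have xP: "rt x (eps x) \<in> aP" using xR by (simp add: rt_P_iff)
  have "rt x (eps x) \<in> J" using ideal_summand'[OF J nP xP] sum ny by simp
  moreover have "rt x (eps x) \<notin> X" using partition_sum[OF part n] sum ny by metis
  ultimately show ?thesis using part by (auto simp: bipartition_def)
qed

text \<open>Climbing puts \<beta> - \<delta> into \<open>X\<close>, so by
  \<open>opposite_string_disjoint\<close> the strings of - x and - y avoid \<open>X\<close>. Either
  - w + j\<delta> is a sum of two roots of these strings, hence in \<open>Y\<close>, or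
  \<open>j\<close> is too low for that, and then \<beta> - \<delta> is a sum of two roots of
  \<open>Y\<close>.\<close>

lemma string_sum_contradiction:
  assumes F: "frontier_root J (rt w k)" and part: "bipartition J X Y"
    and h: "string_forced X w k" and Y: "\<gamma>1 \<in> Y" "\<gamma>2 \<in> Y" "rt w k = \<gamma>1 + \<gamma>2"
  shows False
proof -
  note pt = partition_swap[OF part]
  note XY = partition_mem[OF F part] and YX = partition_mem(4)[OF F pt]
  have YP: "Y \<subseteq> aP" using XY by (auto simp: ideal_def)
  obtain i j where X: "i < k" "rt w i \<in> X" "rt (- w) j \<in> X" using h unfolding string_forced_def by blast
  obtain x p y q where rts: "\<gamma>1 = rt x p" "\<gamma>2 = rt y q"
    using P_rt[of \<gamma>1] P_rt[of \<gamma>2] Y YP by blast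
  have wk: "w = x + y" "k = p + q" using Y(3) rts by (auto simp: rt_add)
  have x: "rt x p \<in> Y" and y: "rt y q \<in> Y" using Y rts by auto
  have xR: "x \<in> \<Phi>" "eps x \<le> p" and yR: "y \<in> \<Phi>" "eps y \<le> q" using YX x y by auto
  have wR: "w \<in> \<Phi>" "eps w \<le> i" and nw: "eps (- w) \<le> j" using XY(4) X by auto
  have w1J: "rt w (k - 1) \<in> J" using rt_minus_delta[OF F] wR X by simp
  have w1X: "rt w (k - 1) \<in> X"
    using partition_string[OF XY(3) part X(2,3) refl w1J] X by (cases "i = k - 1") auto
  have F': "frontier_root J (rt (y + x) (q + p))" and w1X': "rt (y + x) (q + p - 1) \<in> X"
    using F w1X wk by (simp_all add: add.commute)
  note nx = opposite_string_disjoint[OF F[unfolded wk] part w1X[unfolded wk] x y]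
  note ny = opposite_string_disjoint[OF F' part w1X' y x]
  note e = eps_neg[OF xR(1)] eps_neg[OF yR(1)] eps_neg[OF wR(1)]
  show False
  proof (cases "j \<ge> eps (- x) + eps (- y)")
    case True
    have P: "rt (- x) (j - eps (- y)) \<in> aP" "rt (- y) (eps (- y)) \<in> aP"
      using True xR yR neg_root by (auto simp: rt_P_iff)
    have sum: "rt (- x) (j - eps (- y)) + rt (- y) (eps (- y)) = rt (- w) j" by (simp add: rt_add wk)
    have nwJ: "rt (- w) j \<in> J" using X XY by auto
    have "rt (- x) (j - eps (- y)) \<in> J" using ideal_summand[OF XY(3) P] sum nwJ by simp
    then have "rt (- x) (j - eps (- y)) \<in> Y" "rt (- y) (eps (- y)) \<in> Y" using nx(2) ny XY by auto
    then have "rt (- w) j \<in> Y" using partition_sum[OF pt] sum nwJ by metis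
    then show False using X XY by auto
  next
    case False
    \<comment> \<open>\<open>eps (- x) + eps (- y)\<close> is 2 - eps x - eps y, while
      \<open>j\<close> is at least \<open>eps (- w)\<close>, hence at least 1 - eps x - eps y; only
      one value is left.\<close>
    have j: "j = 1 - eps x - eps y" using False e nw eps_add[of x y] wk by simp
    have lx: "rt x (eps x) \<in> Y" and ly: "rt y (eps y) \<in> Y"
      using lowest_in_complement[OF XY(3) part xR(1) yR(1) _ j ny(1) ny(2)]
        lowest_in_complement[OF XY(3) part yR(1) xR(1) _ _ nx(1) nx(2), of j] X(3) j
      by (simp_all add: wk add.commute)
    \<comment> \<open>The level that completes y + (eps y)\<delta> to \<beta> - \<delta>. It is at
      least eps x, because the value of \<open>j\<close> gives eps x + eps y \<le> eps w, and eps w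
      < k.\<close>
    define s where "s = k - 1 - eps y"
    have s: "eps x \<le> s" using j e nw wR X(1) by (simp add: s_def)
    have sum: "rt x s + rt y (eps y) = rt w (k - 1)" by (simp add: rt_add wk s_def)
    have P: "rt x s \<in> aP" "rt y (eps y) \<in> aP" using s xR yR by (auto simp: rt_P_iff)
    have sJ: "rt x s \<in> J" using ideal_summand[OF XY(3) P] sum w1J by simp
    have nxY: "rt (- x) (eps (- x)) \<in> Y" using nx XY by auto
    have "rt x s \<in> Y"
      using partition_string[OF XY(3) pt lx nxY refl sJ] lx s by (cases "s = eps x") auto
    then have "rt w (k - 1) \<in> Y" using partition_sum[OF pt _ ly] sum w1J by metis
    then show False using w1X XY by auto
  qed
qed

lemma deg_triple_frontier_forced:
  assumes F: "frontier_root J (rt x k)" and part: "bipartition J X Y"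
    and \<alpha>: "\<alpha> \<in> X" and \<gamma>: "\<gamma> \<in> Y" and d: "deg_triple \<gamma> (rt x k) \<alpha>"
  shows "forced Y (rt x k)"
proof -
  note pt = partition_swap[OF part]
  note XY = partition_mem[OF F part] and YX = partition_mem(4)[OF F pt]
  have JP: "J \<subseteq> aP" using XY by (auto simp: ideal_def)
  then obtain z m y l where rts: "\<alpha> = rt z m" "\<gamma> = rt y l"
    using P_rt[of \<alpha>] P_rt[of \<gamma>] \<alpha> \<gamma> XY(1) by blast
  have zX: "rt z m \<in> X" and yY: "rt y l \<in> Y" using \<alpha> \<gamma> rts by auto
  have J: "rt z m \<in> J" "rt y l \<in> J" using zX yY XY by auto
  have P: "rt x k \<in> aP" "rt z m \<in> aP" "rt y l \<in> aP" using J JP F by (auto simp: frontier_root_def)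
  have x: "x \<in> \<Phi>" "eps x \<le> k" and zR: "eps z \<le> m" and yR: "eps y \<le> l"
    using P rt_P_iff by blast+
  note e = eps_neg[OF x(1)]
  obtain a b where ab: "a > 0" "b > 0" "of_int l = a * of_int k + b * (of_int m :: real)"
    and c: "x = y \<and> z = y \<and> a + b = 1 \<or> x = y \<and> z = - y \<and> a = 1 + b \<or> x = - y \<and> z = y \<and> b = 1 + a"
    using deg_triple_coords[OF P(1,2,3) d[unfolded rts]] by blast
  from c show ?thesis
  proof (elim disjE conjE)
    \<comment> \<open>All in one string, with \<alpha> below \<gamma> below \<beta>. The lowest
      opposite root cannot be in \<open>X\<close>, or \<alpha> would climb to \<gamma>; so it is in
      \<open>Y\<close> and lets \<gamma> climb to \<beta>.\<close>
    assume h: "x = y" "z = y" "a + b = 1"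
    have lk: "l < k" using frontier_string_less[OF F] J h by simp
    have ml: "m < l"
    proof (rule ccontr)
      assume "\<not> m < l"
      then have "m \<noteq> l" "l \<le> m" using zX yY XY h by auto
      \<comment> \<open>Negating the levels turns the upper bound for convex combinations into a
        lower one.\<close>
      then have "- k < - l" "- m < - l" using lk by auto
      moreover have "of_int (- l) = a * of_int (- k) + b * (of_int (- m) :: real)" using ab(3) by simp
      ultimately show False using convex_combination_le[OF ab(1,2) h(3), of "- l" "- k" "- m"] by simp
    qed
    have nJ: "rt (- x) (eps (- x)) \<in> J"
    proof (rule rt_below_frontier[OF F neg_root[OF x(1)] order_refl])
      show "rt (x - - x) (k - eps (- x)) \<in> span_plus aD"
        using rt_sum_cone[OF x(1) x(1), of "k - eps (- x)"] lk yR h e by simp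
      have "- x \<noteq> x"
      proof
        assume "- x = x"
        then have "eps x = 1 - eps x" using e by simp
        then show False by presburger
      qed
      then show "- x \<noteq> x \<or> eps (- x) \<noteq> k" by simp
    qed
    have "rt (- x) (eps (- x)) \<notin> X"
      using partition_string[OF XY(3) part zX, of "- x" "eps (- x)" l] J ml h yY XY by auto
    then have "rt (- x) (eps (- x)) \<in> Y" using nJ XY by auto
    then show ?thesis using string_forced_forced[OF F pt, of x l _ k] yY h lk by simp
  next
    assume h: "x = y" "z = - y" "a = 1 + b"
    have "k < l" using reflected_combination_less[OF ab(2) h(3) ab(3)] neg_sum_pos[OF x] zR h by simp
    then show ?thesis using frontier_string_less[OF F, of l] J h by simp
  next
    \<comment> \<open>\<alpha> and \<gamma> lie in the string opposite to \<beta>, \<alpha> below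
      \<gamma>. The root \<beta> - \<delta> cannot be in \<open>X\<close>, or \<alpha> would climb
      to \<gamma>; so it is in \<open>Y\<close> and climbs to \<beta> with the help of \<gamma>. It
      is positive, since otherwise \<beta> would be the bottom of its string and lie below
      \<gamma>.\<close>
    assume h: "x = - y" "z = y" "b = 1 + a"
    have y: "y = - x" using h by simp
    have ml: "m < l"
      using reflected_combination_less[OF ab(1) h(3), of l m k] ab(3) neg_sum_pos[OF x, of m] zR h by simp
    have "eps x \<noteq> k"
    proof
      assume k: "eps x = k"
      have "rt (- x + - x) (l - k) \<in> span_plus aD"
        using ml zR h e k by (intro rt_sum_cone neg_root x) simp
      then have "root_le aD (rt x k) (rt y l)" by (simp add: root_le_def rt_diff y)
      then show False using frontier_root_not_le[OF F J(2)] by simp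
    qed
    then have k1J: "rt x (k - 1) \<in> J" using rt_minus_delta[OF F] x by simp
    have "rt x (k - 1) \<notin> X"
      using partition_string[OF XY(3) part zX, of x "k - 1" l] J ml h yY XY by auto
    then have "rt x (k - 1) \<in> Y" using k1J XY by auto
    then show ?thesis using string_forced_forced[OF F pt, of x "k - 1" l k] yY y by simp
  qed
qed

sublocale extendable_root_cone aP aD fst ht
proof
  fix J \<beta> X Y assume F: "frontier_root J \<beta>" and part: "bipartition J X Y"
  obtain x k where b: "\<beta> = rt x k" using P_rt F unfolding frontier_root_def by blast
  note F' = F[unfolded b] and pt = partition_swap[OF part]
  show False if forc: "forced X \<beta>" "forced Y \<beta>"
    using forced_cases[OF F' part forc(1)[unfolded b]] forced_cases[OF F' pt forc(2)[unfolded b]]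
  proof (elim disjE bexE)
    fix \<alpha>1 \<alpha>2 \<gamma>1 \<gamma>2
    assume "\<alpha>1 \<in> X" "\<alpha>2 \<in> X" "rt x k = \<alpha>1 + \<alpha>2" "\<gamma>1 \<in> Y" "\<gamma>2 \<in> Y" "rt x k = \<gamma>1 + \<gamma>2"
    then show False by (rule sum_sum_contradiction[OF F' part])
  next
    fix \<alpha>1 \<alpha>2 assume "string_forced Y x k" "\<alpha>1 \<in> X" "\<alpha>2 \<in> X" "rt x k = \<alpha>1 + \<alpha>2"
    then show False by (rule string_sum_contradiction[OF F' pt])
  next
    fix \<gamma>1 \<gamma>2 assume "string_forced X x k" "\<gamma>1 \<in> Y" "\<gamma>2 \<in> Y" "rt x k = \<gamma>1 + \<gamma>2"
    then show False by (rule string_sum_contradiction[OF F' part])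
  next
    assume "string_forced X x k" "string_forced Y x k"
    then show False by (rule string_string_contradiction[OF F' part])
  qed
  show "forced Y \<beta>" if "\<alpha> \<in> X" "\<gamma> \<in> Y" "deg_triple \<gamma> \<beta> \<alpha>" for \<alpha> \<gamma>
    using deg_triple_frontier_forced[OF F' part that(1,2)] that(3) b by simp
qed

end

lemma affine_extension_property:
  fixes \<Phi> \<Delta> :: "'a::euclidean_space set"
  assumes R: "finite_root_system \<Phi>" and base: "is_base \<Phi> \<Delta>" and highest: "highest_root \<Phi> \<Delta> \<theta>"
  shows "biclosed_extension_property (aff_roots \<Phi>) (aff_base \<Delta> \<theta>)"
proof -
  from base_height_exists[OF base] obtain f :: "'a \<Rightarrow> real" where f: "linear f"
    "(\<forall>x\<in>\<Phi>. f x \<in> \<int>) \<and> (\<forall>v\<in>span_plus \<Delta>. 0 \<le> f v \<and> (f v = 0 \<longrightarrow> v = 0))"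
    by (elim exE conjE) simp
  interpret affine_root_system \<Phi> \<Delta> \<theta> f
    by (rule affine_root_system.intro) (use R base highest f in simp_all)
  show ?thesis by (rule extension_property) simp
qed

theorem theoremC:
  fixes \<Phi> \<Delta> \<Phi>0 \<Delta>0 :: "'a::euclidean_space set" and \<theta> :: 'a
  shows "(finite_root_system \<Phi> \<and> is_base \<Phi> \<Delta> \<longrightarrow> biclosed_extension_property \<Phi> \<Delta>) \<and>
         (finite_root_system \<Phi>0 \<and> is_base \<Phi>0 \<Delta>0 \<and> irreducible_rs \<Phi>0 \<and> card \<Delta>0 = 2 \<and>
          highest_root \<Phi>0 \<Delta>0 \<theta> \<longrightarrow>
            biclosed_extension_property (aff_roots \<Phi>0) (aff_base \<Delta>0 \<theta>))"
  using finite_extension_property[of \<Phi> \<Delta>] affine_extension_property[of \<Phi>0 \<Delta>0 \<theta>] by blast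

end
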